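(* Let $k,l$ be integers. The double twist link $J(k,l)$ is $(S_3,4)$-colorable if and only if $kl\equiv 3 \pmod 4$, and is $(S_3,3)$-colorable if and only if $kl\equiv 2\pmod 3$.
   Context: $S_3$ is the symmetric group of degree 3, with identity $e$. Links are oriented links in $S^3$ (knots are one-component links), and $D$ denotes an oriented link diagram. An $S_3$-coloring on $D$ is a map $\Gamma$ from the set of arcs of $D$ to $S_3\setminus\{e\}$ such that at each crossing, with over arc $x$, under arc $y$ before passing through the crossing and under arc $z$ after passing through it, one has $\Gamma(x)\Gamma(y)=\Gamma(z)\Gamma(x)$ if the crossing is positive, and $\Gamma(x)\Gamma(z)=\Gamma(y)\Gamma(x)$ if the crossing is negative. For $n\in\{1,2,3,4,5\}$, an $(S_3,n)$-coloring is an $S_3$-coloring whose image has exactly $n$ elements (it uses $n$ colors). A link is $(S_3,n)$-colorable if it has some diagram admitting an $(S_3,n)$-coloring. The double twist link $J(k,l)$ is the link with the standard diagram consisting of two twist regions, one with $k$ crossings (half twists) and one with $l$ crossings (half twists), joined to form the 2-bridge link with Conway notation $C(k,l)$, i.e. the 2-bridge (rational) link associated with the continued fraction $k+\frac{1}{l}=\frac{kl+1}{l}$. The sign convention is such that the diagram is alternating when $k,l>0$ and the determinant of $J(k,l)$ is $|1+kl|$ (for instance $J(1,1)$ is the Hopf link and $J(1,3)$ is, up to mirror image, the torus link $T(2,4)$). *)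

theory Defs
  imports "HOL-Algebra.Sym_Groups" "HOL-Number_Theory.Cong"
begin

text \<open>
  A link diagram is put in general position with respect to the height function of the plane and
  read from bottom to top as a list of elementary layers.  A layer \<open>(i, e)\<close> has one
  elementary piece \<open>e\<close>, with exactly \<open>i\<close> vertical strands to its left;
  all other strands go straight up.  Every link diagram has this form up to planar isotopy.

  \<open>Cup\<close> is a local minimum, \<open>Cap\<close> a local maximum.  In \<open>Cross b\<close> the over
  strand runs between the lower left and the upper right end if \<open>b\<close>, and between the lower right
  and the upper left end otherwise.  The label of a cup carries the orientation: in
  \<open>Cup d\<close> the left leg points upwards if \<open>d\<close>, and the right leg points upwards
  otherwise.  Cups are labelled by \<^typ>\<open>unit\<close> in unoriented diagrams.
\<close>

datatype 'd piece = Cup 'd | Cap | Cross bool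

type_synonym 'd diagram = "(nat \<times> 'd piece) list"

fun strands_below :: "'d piece \<Rightarrow> nat" where
  "strands_below (Cup d) = 0"
| "strands_below Cap = 2"
| "strands_below (Cross b) = 2"

fun strands_above :: "'d piece \<Rightarrow> nat" where
  "strands_above (Cup d) = 2"
| "strands_above Cap = 0"
| "strands_above (Cross b) = 2"

text \<open>A horizontal level is described by the list of its strands from left to right, where
  \<^const>\<open>True\<close> stands for a strand oriented upwards.\<close>

fun admissible :: "bool list \<Rightarrow> nat \<times> bool piece \<Rightarrow> bool" where
  "admissible s (i, Cup d) \<longleftrightarrow> i \<le> length s"
| "admissible s (i, Cap) \<longleftrightarrow> i + 1 < length s \<and> s ! i \<noteq> s ! (i + 1)"
| "admissible s (i, Cross b) \<longleftrightarrow> i + 1 < length s"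

fun next_level :: "bool list \<Rightarrow> nat \<times> bool piece \<Rightarrow> bool list" where
  "next_level s (i, Cup d) = take i s @ [d, \<not> d] @ drop i s"
| "next_level s (i, Cap) = take i s @ drop (i + 2) s"
| "next_level s (i, Cross b) = take i s @ [s ! (i + 1), s ! i] @ drop (i + 2) s"

definition level :: "bool diagram \<Rightarrow> nat \<Rightarrow> bool list" where
  "level D h = foldl next_level [] (take h D)"

definition oriented_diagram :: "bool diagram \<Rightarrow> bool" where
  "oriented_diagram D \<longleftrightarrow>
     (\<forall>h < length D. admissible (level D h) (D ! h)) \<and> level D (length D) = []"

definition forget_orientation :: "bool diagram \<Rightarrow> unit diagram" where
  "forget_orientation D = map (map_prod id (map_piece (\<lambda>_. ()))) D"


subsection \<open>Arcs and crossings\<close>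

text \<open>The point \<open>(h, j)\<close> is the intersection of the diagram with level \<open>h\<close> on its
  \<open>j\<close>-th strand.  The layer \<open>D ! h\<close> lies between the levels \<open>h\<close> and \<open>h + 1\<close>.\<close>

definition points :: "bool diagram \<Rightarrow> (nat \<times> nat) set" where
  "points D = {(h, j). h \<le> length D \<and> j < length (level D h)}"

text \<open>Two points are joined if a segment of the diagram inside a single layer connects them without
  passing under a crossing; arcs are the resulting classes of points.  A component that never passes
  under a crossing thus forms one arc.\<close>

inductive joined :: "bool diagram \<Rightarrow> nat \<times> nat \<Rightarrow> nat \<times> nat \<Rightarrow> bool" for D where
  left: "h < length D \<Longrightarrow> D ! h = (i, e) \<Longrightarrow> j < i \<Longrightarrow> joined D (h, j) (h + 1, j)"
| right: "h < length D \<Longrightarrow> D ! h = (i, e) \<Longrightarrow> i + strands_below e \<le> j \<Longrightarrow>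
    j < length (level D h) \<Longrightarrow> joined D (h, j) (h + 1, j - strands_below e + strands_above e)"
| cup: "h < length D \<Longrightarrow> D ! h = (i, Cup d) \<Longrightarrow> joined D (h + 1, i) (h + 1, i + 1)"
| cap: "h < length D \<Longrightarrow> D ! h = (i, Cap) \<Longrightarrow> joined D (h, i) (h, i + 1)"
| over_right: "h < length D \<Longrightarrow> D ! h = (i, Cross True) \<Longrightarrow> joined D (h, i) (h + 1, i + 1)"
| over_left: "h < length D \<Longrightarrow> D ! h = (i, Cross False) \<Longrightarrow> joined D (h, i + 1) (h + 1, i)"

definition arc_of :: "bool diagram \<Rightarrow> nat \<times> nat \<Rightarrow> (nat \<times> nat) set" where
  "arc_of D p = {q. equivclp (joined D) p q}"

definition arcs :: "bool diagram \<Rightarrow> (nat \<times> nat) set set" where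
  "arcs D = arc_of D ` points D"

definition crossing_at :: "bool diagram \<Rightarrow> nat \<Rightarrow> bool" where
  "crossing_at D h \<longleftrightarrow> h < length D \<and> (\<exists>i b. D ! h = (i, Cross b))"

text \<open>The sign of \<open>Cross b\<close> when both strands point upwards is positive iff \<open>b\<close>, and it
  changes whenever one strand is reversed.\<close>

definition positive :: "bool diagram \<Rightarrow> nat \<Rightarrow> bool" where
  "positive D h = (case D ! h of (i, Cross b) \<Rightarrow> b = (level D h ! i = level D h ! (i + 1)))"

definition over_arc :: "bool diagram \<Rightarrow> nat \<Rightarrow> (nat \<times> nat) set" where
  "over_arc D h = (case D ! h of (i, Cross b) \<Rightarrow> arc_of D (h, if b then i else i + 1))"

definition lower_under_arc :: "bool diagram \<Rightarrow> nat \<Rightarrow> (nat \<times> nat) set" where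
  "lower_under_arc D h = (case D ! h of (i, Cross b) \<Rightarrow> arc_of D (h, if b then i + 1 else i))"

definition upper_under_arc :: "bool diagram \<Rightarrow> nat \<Rightarrow> (nat \<times> nat) set" where
  "upper_under_arc D h = (case D ! h of (i, Cross b) \<Rightarrow> arc_of D (h + 1, if b then i else i + 1))"

definition under_upwards :: "bool diagram \<Rightarrow> nat \<Rightarrow> bool" where
  "under_upwards D h = (case D ! h of (i, Cross b) \<Rightarrow> level D h ! (if b then i + 1 else i))"

definition under_arc_before :: "bool diagram \<Rightarrow> nat \<Rightarrow> (nat \<times> nat) set" where
  "under_arc_before D h =
     (if under_upwards D h then lower_under_arc D h else upper_under_arc D h)"

definition under_arc_after :: "bool diagram \<Rightarrow> nat \<Rightarrow> (nat \<times> nat) set" where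
  "under_arc_after D h =
     (if under_upwards D h then upper_under_arc D h else lower_under_arc D h)"


subsection \<open>Colorings\<close>

abbreviation S3 :: "(nat \<Rightarrow> nat) monoid" where
  "S3 \<equiv> sym_group 3"

definition S3_coloring :: "bool diagram \<Rightarrow> ((nat \<times> nat) set \<Rightarrow> nat \<Rightarrow> nat) \<Rightarrow> bool" where
  "S3_coloring D \<Gamma> \<longleftrightarrow>
     \<Gamma> \<in> arcs D \<rightarrow> carrier S3 - {\<one>\<^bsub>S3\<^esub>} \<and>
     (\<forall>h. crossing_at D h \<longrightarrow>
        (let x = over_arc D h; y = under_arc_before D h; z = under_arc_after D h in
         if positive D h then \<Gamma> x \<otimes>\<^bsub>S3\<^esub> \<Gamma> y = \<Gamma> z \<otimes>\<^bsub>S3\<^esub> \<Gamma> x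
         else \<Gamma> x \<otimes>\<^bsub>S3\<^esub> \<Gamma> z = \<Gamma> y \<otimes>\<^bsub>S3\<^esub> \<Gamma> x))"

definition S3_n_coloring ::
  "nat \<Rightarrow> bool diagram \<Rightarrow> ((nat \<times> nat) set \<Rightarrow> nat \<Rightarrow> nat) \<Rightarrow> bool" where
  "S3_n_coloring n D \<Gamma> \<longleftrightarrow> S3_coloring D \<Gamma> \<and> card (\<Gamma> ` arcs D) = n"


subsection \<open>Links\<close>

text \<open>
  Oriented links in the 3-sphere are represented by their diagrams up to planar isotopy and
  Reidemeister moves.  For diagrams sliced into layers, planar isotopy is generated by the first
  rules below: exchanging the heights of two distant pieces, straightening a zigzag, and sliding a
  strand across a local extremum.  The second and third Reidemeister moves are only needed in
  vertical position, the other positions follow by planar isotopy.  The side condition of the third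
  move says that its three strands lie at three different heights over the plane.
\<close>

inductive local_move :: "bool diagram \<Rightarrow> bool diagram \<Rightarrow> bool" where
  exchange: "i + strands_above e \<le> j \<Longrightarrow>
    local_move [(i, e), (j, f)] [(j - strands_above e + strands_below e, f), (i, e)]"
| zigzag_left: "local_move [(i, Cup d), (i + 1, Cap)] []"
| zigzag_right: "local_move [(i + 1, Cup d), (i, Cap)] []"
| slide_cap: "local_move [(i, Cross b), (i + 1, Cap)] [(i + 1, Cross (\<not> b)), (i, Cap)]"
| slide_cup: "local_move [(i + 1, Cup d), (i, Cross b)] [(i, Cup d), (i + 1, Cross (\<not> b))]"
| reidemeister1_cap: "local_move [(i, Cross b), (i, Cap)] [(i, Cap)]"
| reidemeister1_cup: "local_move [(i, Cup d), (i, Cross b)] [(i, Cup (\<not> d))]"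
| reidemeister2: "local_move [(i, Cross b), (i, Cross (\<not> b))] []"
| reidemeister3: "b = a \<or> b = c \<Longrightarrow>
    local_move [(i, Cross a), (i + 1, Cross b), (i, Cross c)]
               [(i + 1, Cross c), (i, Cross b), (i + 1, Cross a)]"

definition move :: "bool diagram \<Rightarrow> bool diagram \<Rightarrow> bool" where
  "move D D' \<longleftrightarrow> oriented_diagram D \<and> oriented_diagram D' \<and>
     (\<exists>A B T T'. local_move T T' \<and> D = A @ T @ B \<and> D' = A @ T' @ B)"

text \<open>The link represented by a diagram, as the set of all its diagrams.\<close>

definition link_of :: "bool diagram \<Rightarrow> bool diagram set" where
  "link_of D = {D'. equivclp move D D'}"

definition S3_colorable :: "nat \<Rightarrow> bool diagram set \<Rightarrow> bool" where
  "S3_colorable n L \<longleftrightarrow> (\<exists>D \<in> L. \<exists>\<Gamma>. S3_n_coloring n D \<Gamma>)"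


subsection \<open>Double twist links\<close>

text \<open>
  The standard diagram of the 2-bridge link \<open>C(k, l)\<close> as a 4-plat: \<open>\<bar>k\<bar>\<close> half twists of the two
  middle strands, followed by \<open>\<bar>l\<bar>\<close> half twists of the two leftmost strands, with two adjacent
  minima and two nested maxima.  As in an alternating braid, half twists of equal sign in the two
  regions are crossings of opposite type.
\<close>

definition double_twist :: "int \<Rightarrow> int \<Rightarrow> unit diagram" where
  "double_twist k l =
     [(0, Cup ()), (2, Cup ())]
     @ replicate (nat \<bar>k\<bar>) (1, Cross (k < 0))
     @ replicate (nat \<bar>l\<bar>) (0, Cross (l > 0))
     @ [(1, Cap), (0, Cap)]"

end

theory Submission
  imports Defs
begin

text \<open>
  A coloring is a representation of the link group in \<open>S\<^sub>3\<close> that sends meridians to non-trivial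
  elements, so it can be carried along Reidemeister moves; only the number of colors changes on the way.
  What survives is recorded here by the \<^emph>\<open>subracks\<close> of the group, the sets of elements closed
  under inversion and under conjugation by their own members: two diagrams related by moves have matching
  colorings whose colors lie in the same subracks (\<open>link_coloring\<close>).  The argument becomes independent
  of orientations when a strand carries its color if it is directed upwards and the inverse of its color
  otherwise.  A crossing then acts on the two colors next to it as a braid generator, by
  \<open>half_twist\<close>, and the colorings of the standard diagram can be computed by following the two twist regions.

  The elements of \<open>S\<^sub>3\<close> different from the identity are three reflections and two rotations, the symmetries
  of a triangle.  Four colors must include elements of both kinds.  A double twist link
  colored by both kinds has two components, one for each kind.  A twist region in which both kinds meet repeats its colors
  after four half twists (\<open>mixed_twists\<close>), and comparing the two ends of the twist regions leaves only
  \<open>k l = 3\<close> modulo 4 (\<open>mixed_double_twist\<close>).  Conversely, if \<open>k l = 3\<close> modulo 4, the kinds can be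
  distributed over the two components so that both twist regions run through the same four pairs of colors,
  in which only two reflections occur.  A second Reidemeister move that pulls the reflection strand over the
  rotation strand makes sure that both rotations are colors (\<open>four_colors_diagram\<close>).

  Three colors may be the three reflections, as in a Fox 3-coloring.  In a twist region the reflections
  then form an arithmetic progression modulo 3, the increment is multiplied by \<open>k\<close> from the first region to
  the second, and closing up the diagram requires \<open>(1 + k l) d = 0\<close> modulo 3 for the initial increment \<open>d\<close>
  (\<open>reflections_double_twist\<close>).  So a coloring by reflections that is not constant exists
  if and only if \<open>k l = 2\<close> modulo 3, and then three colors occur on the standard diagram.
  Any other coloring by three colors can be replaced by one of this kind on the same diagram.
  If the colors are two reflections and one rotation, no strand of rotation color can pass under a reflection,
  and renaming the three colors bijectively as the three reflections respects all
  crossings (\<open>recolor_rotation\<close>).  If they are one reflection \<open>a\<close> and both rotations, no strand colored \<open>a\<close>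
  can pass under a rotation.  The strands of rotation color are then given a second or a third reflection,
  according to the parity of the number of strands colored \<open>a\<close> to their left
  (\<open>recolor_tangle\<close>).
\<close>

section \<open>Colorings of tangles by group elements\<close>

fun strands :: "'a \<times> 'a \<Rightarrow> 'a list" where
  "strands (g, h) = [g, h]"

lemma strands_cases: "strands p = [fst p, snd p]"
  by (cases p) simp

context group
begin

lemma inv_mult_cancel_left [simp]:
  "x \<in> carrier G \<Longrightarrow> y \<in> carrier G \<Longrightarrow> inv x \<otimes> (x \<otimes> y) = y"
  "x \<in> carrier G \<Longrightarrow> y \<in> carrier G \<Longrightarrow> x \<otimes> (inv x \<otimes> y) = y"
  by (simp_all flip: m_assoc)

text \<open>
  The colors below a crossing determine those above it.  With upward colors this is the action of a
  braid generator or of its inverse; both preserve the product of the two colors.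
\<close>

fun half_twist :: "bool \<Rightarrow> 'a \<times> 'a \<Rightarrow> 'a \<times> 'a" where
  "half_twist True (g, h) = (g \<otimes> h \<otimes> inv g, g)"
| "half_twist False (g, h) = (h, inv h \<otimes> g \<otimes> h)"

inductive piece_coloring :: "'d piece \<Rightarrow> 'a list \<Rightarrow> 'a list \<Rightarrow> bool" where
  "g \<in> carrier G \<Longrightarrow> piece_coloring (Cup d) [] [g, inv g]"
| "g \<in> carrier G \<Longrightarrow> piece_coloring Cap [g, inv g] []"
| "piece_coloring (Cross b) (strands p) (strands (half_twist b p))"

lemma piece_coloring_simps [simp]:
  "piece_coloring (Cup d) u v \<longleftrightarrow> (\<exists>g \<in> carrier G. u = [] \<and> v = [g, inv g])"
  "piece_coloring Cap u v \<longleftrightarrow> (\<exists>g \<in> carrier G. u = [g, inv g] \<and> v = [])"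
  "piece_coloring (Cross b) u v \<longleftrightarrow> (\<exists>p. u = strands p \<and> v = strands (half_twist b p))"
  by (auto simp: piece_coloring.simps)

lemma piece_coloring_length:
  "piece_coloring e u v \<Longrightarrow> length u = strands_below e \<and> length v = strands_above e"
  by (induction rule: piece_coloring.induct) (auto simp: strands_cases)

text \<open>
  Decomposing the level as \<open>A @ u @ B\<close> makes it possible to slide distant pieces past each other without
  distinguishing what the pieces are.
\<close>

definition layer_coloring :: "'a list \<Rightarrow> nat \<times> 'd piece \<Rightarrow> 'a list \<Rightarrow> bool" where
  "layer_coloring s p t \<longleftrightarrow>
     (\<exists>A B u v. s = A @ u @ B \<and> t = A @ v @ B \<and> length A = fst p \<and> piece_coloring (snd p) u v)"

lemma layer_coloring_0:
  "layer_coloring s (0, e) t \<longleftrightarrow> (\<exists>B u v. s = u @ B \<and> t = v @ B \<and> piece_coloring e u v)"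
  unfolding layer_coloring_def fst_conv snd_conv length_0_conv
  by (metis append.left_neutral)

lemma layer_coloring_append:
  "layer_coloring (A @ s) (length A + n, e) t \<longleftrightarrow> (\<exists>t'. t = A @ t' \<and> layer_coloring s (n, e) t')"
proof
  assume "layer_coloring (A @ s) (length A + n, e) t"
  then obtain A' B u v where *: "A @ s = A' @ u @ B" "t = A' @ v @ B" "length A' = length A + n"
      "piece_coloring e u v"
    by (auto simp: layer_coloring_def)
  define C where "C = drop (length A) A'"
  have "take (length A) (A @ s) = take (length A) A'" using *(1,3) by simp
  hence "A' = A @ C" unfolding C_def by (metis append_eq_conv_conj append_take_drop_id)
  with * show "\<exists>t'. t = A @ t' \<and> layer_coloring s (n, e) t'"
    by (auto simp: layer_coloring_def)
next
  assume "\<exists>t'. t = A @ t' \<and> layer_coloring s (n, e) t'"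
  then obtain A' B u v where "s = A' @ u @ B" "t = A @ A' @ v @ B" "length A' = n"
      "piece_coloring e u v"
    by (auto simp: layer_coloring_def)
  thus "layer_coloring (A @ s) (length A + n, e) t"
    unfolding layer_coloring_def by (intro exI[of _ "A @ A'"] exI[of _ B] exI) auto
qed

lemma layer_coloring_append_simps:
  "layer_coloring (A @ s) (length A, e) t \<longleftrightarrow> (\<exists>t'. t = A @ t' \<and> layer_coloring s (0, e) t')"
  "layer_coloring (A @ s) (Suc (length A), e) t \<longleftrightarrow>
     (\<exists>t'. t = A @ t' \<and> layer_coloring s (Suc 0, e) t')"
  using layer_coloring_append[of A s 0 e t] layer_coloring_append[of A s 1 e t] by simp_all

lemma layer_coloring_Suc [simp]:
  "layer_coloring (x # s) (Suc n, e) t \<longleftrightarrow> (\<exists>t'. t = x # t' \<and> layer_coloring s (n, e) t')"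
  "\<not> layer_coloring [] (Suc n, e) t"
  using layer_coloring_append[of "[x]" s n e t] by (simp_all add: layer_coloring_def)

lemma layer_coloring_length:
  "layer_coloring s (i, e) t \<Longrightarrow>
     i + strands_below e \<le> length s \<and> length t + strands_below e = length s + strands_above e"
  unfolding layer_coloring_def using piece_coloring_length by fastforce

lemma layer_coloring_cup_0:
  "layer_coloring s (0, Cup d) t \<longleftrightarrow> (\<exists>g\<in>carrier G. t = g # inv g # s)"
  unfolding layer_coloring_0 piece_coloring_simps by fastforce

lemma layer_coloring_cap_0:
  "layer_coloring s (0, Cap) t \<longleftrightarrow> (\<exists>g\<in>carrier G. s = g # inv g # t)"
  by (auto simp: layer_coloring_0)

lemma layer_coloring_cross_0:
  "layer_coloring (g # h # B) (0, Cross b) t \<longleftrightarrow> t = strands (half_twist b (g, h)) @ B"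
proof
  assume "t = strands (half_twist b (g, h)) @ B"
  hence "g # h # B = strands (g, h) @ B \<and> t = strands (half_twist b (g, h)) @ B \<and>
     piece_coloring (Cross b) (strands (g, h)) (strands (half_twist b (g, h)))"
    using piece_coloring.intros(3)[of b "(g, h)"] by (simp del: piece_coloring_simps)
  thus "layer_coloring (g # h # B) (0, Cross b) t" unfolding layer_coloring_0 by blast
qed (auto simp: strands_cases layer_coloring_0)

text \<open>
  Every local move happens within three adjacent strands.  These rules compute the effect of a layer
  on such a window when the strands to its left are kept as an unspecified list \<open>A\<close>.
\<close>

lemma layer_coloring_window:
  "layer_coloring (A @ s) (length A, Cup d) t \<longleftrightarrow> (\<exists>g\<in>carrier G. t = A @ g # inv g # s)"
  "layer_coloring (A @ x # s) (Suc (length A), Cup d) t \<longleftrightarrow>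
     (\<exists>g\<in>carrier G. t = A @ x # g # inv g # s)"
  "layer_coloring (A @ g # h # B) (length A, Cap) t \<longleftrightarrow>
     g \<in> carrier G \<and> h = inv g \<and> t = A @ B"
  "layer_coloring (A @ x # g # h # B) (Suc (length A), Cap) t \<longleftrightarrow>
     g \<in> carrier G \<and> h = inv g \<and> t = A @ x # B"
  "layer_coloring (A @ g # h # B) (length A, Cross b) t \<longleftrightarrow>
     t = A @ strands (half_twist b (g, h)) @ B"
  "layer_coloring (A @ x # g # h # B) (Suc (length A), Cross b) t \<longleftrightarrow>
     t = A @ x # strands (half_twist b (g, h)) @ B"
  by (auto simp: layer_coloring_append_simps layer_coloring_cup_0 layer_coloring_cap_0
      layer_coloring_cross_0)

text \<open>
  The set \<open>X\<close> collects the upward colors on all levels, including both ends.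
\<close>

fun tangle_coloring :: "'a list \<Rightarrow> 'd diagram \<Rightarrow> 'a set \<Rightarrow> 'a list \<Rightarrow> bool" where
  "tangle_coloring s [] X t \<longleftrightarrow> t = s \<and> X = set s"
| "tangle_coloring s (p # T) X t \<longleftrightarrow>
     (\<exists>m Y. layer_coloring s p m \<and> tangle_coloring m T Y t \<and> X = set s \<union> Y)"

lemma tangle_coloring_ends: "tangle_coloring s T X t \<Longrightarrow> set s \<subseteq> X \<and> set t \<subseteq> X"
proof (induction T arbitrary: s X)
  case (Cons p T)
  then obtain m Y where "tangle_coloring m T Y t" "X = set s \<union> Y" by auto
  with Cons.IH[of m Y] show ?case by auto
qed auto

lemma tangle_coloring_append:
  "tangle_coloring s (S @ T) X t \<longleftrightarrow>
     (\<exists>m Y Z. tangle_coloring s S Y m \<and> tangle_coloring m T Z t \<and> X = Y \<union> Z)"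
proof (induction S arbitrary: s X)
  case Nil
  show ?case by simp (metis Un_absorb1 tangle_coloring_ends)
next
  case (Cons p S)
  show ?case unfolding append_Cons tangle_coloring.simps Cons.IH by (simp add: Un_assoc) blast
qed

text \<open>
  A crossing leaves a set of colors invariant if the set is closed under conjugation by its own
  members, and a local extremum if it is closed under inversion.
\<close>

definition subrack :: "'a set \<Rightarrow> bool" where
  "subrack K \<longleftrightarrow> K \<subseteq> carrier G \<and> (\<forall>g\<in>K. inv g \<in> K) \<and> (\<forall>g\<in>K. \<forall>h\<in>K. g \<otimes> h \<otimes> inv g \<in> K)"

lemma subrack_conj:
  assumes "subrack K" "g \<in> K" "h \<in> K"
  shows "g \<otimes> h \<otimes> inv g \<in> K" "inv g \<otimes> h \<otimes> g \<in> K"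
proof -
  show "g \<otimes> h \<otimes> inv g \<in> K" using assms by (auto simp: subrack_def)
  have "inv g \<otimes> h \<otimes> inv (inv g) \<in> K" using assms unfolding subrack_def by blast
  moreover have "inv (inv g) = g" using assms by (auto simp: subrack_def)
  ultimately show "inv g \<otimes> h \<otimes> g \<in> K" by simp
qed

lemma subrack_carrier: "subrack (carrier G)"
  by (auto simp: subrack_def)

text \<open>
  A half twist is invertible within the subrack, so membership passes through a crossing in both directions.
\<close>

lemma crossing_coloring_subrack:
  assumes "subrack K" "layer_coloring s (i, Cross b) t"
  shows "set s \<subseteq> K \<Longrightarrow> set t \<subseteq> K"
    and "set s \<subseteq> carrier G \<Longrightarrow> set t \<subseteq> K \<Longrightarrow> set s \<subseteq> K"
proof -
  obtain A B p where st: "s = A @ strands p @ B" "t = A @ strands (half_twist b p) @ B"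
    using assms(2) unfolding layer_coloring_def piece_coloring_simps snd_conv by blast
  obtain g h where p: "p = (g, h)" by (cases p)
  show "set s \<subseteq> K \<Longrightarrow> set t \<subseteq> K"
    using p st subrack_conj[OF assms(1)] by (cases b) auto
  assume c: "set s \<subseteq> carrier G" and K: "set t \<subseteq> K"
  have gh: "g \<in> carrier G" "h \<in> carrier G" using c st p by auto
  have "g \<in> K \<and> h \<in> K"
  proof (cases b)
    case True
    hence *: "g \<in> K" "g \<otimes> h \<otimes> inv g \<in> K" using K st p by auto
    from subrack_conj(2)[OF assms(1) this] have "h \<in> K" using gh by (simp add: m_assoc)
    with * show ?thesis by simp
  next
    case False
    hence *: "h \<in> K" "inv h \<otimes> g \<otimes> h \<in> K" using K st p by auto
    from subrack_conj(1)[OF assms(1) this] have "g \<in> K" using gh by (simp add: m_assoc)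
    with * show ?thesis by simp
  qed
  thus "set s \<subseteq> K" using K st p by (cases b) auto
qed

lemma layer_coloring_carrier:
  assumes "layer_coloring s p t" "set s \<subseteq> carrier G"
  shows "set t \<subseteq> carrier G"
proof (cases p)
  case (Pair i e)
  show ?thesis
  proof (cases e)
    case (Cross b)
    thus ?thesis using assms Pair crossing_coloring_subrack(1)[OF subrack_carrier] by blast
  qed (use assms Pair in \<open>auto simp: layer_coloring_def\<close>)
qed

lemma tangle_coloring_carrier:
  "tangle_coloring s T X t \<Longrightarrow> set s \<subseteq> carrier G \<Longrightarrow> X \<subseteq> carrier G"
proof (induction T arbitrary: s X)
  case (Cons p T)
  from Cons.prems(1) obtain m Y where m: "layer_coloring s p m" "tangle_coloring m T Y t" "X = set s \<union> Y"
    by auto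
  with Cons.IH[OF m(2)] layer_coloring_carrier[OF m(1)] Cons.prems(2) show ?case by auto
qed auto

section \<open>Invariance under Reidemeister moves\<close>

text \<open>
  The two sides of a local move agree at their ends but may show different colors in between.  The following
  property of a tangle says that its ends already decide in which subracks all its colors lie, so that the
  difference is invisible to subracks.
\<close>

definition spanned :: "'d diagram \<Rightarrow> bool" where
  "spanned T \<longleftrightarrow> (\<forall>s X t K. subrack K \<longrightarrow> tangle_coloring s T X t \<longrightarrow> set s \<subseteq> K \<longrightarrow> set t \<subseteq> K \<longrightarrow> X \<subseteq> K)"

lemma spanned_Nil [simp]: "spanned []"
  unfolding spanned_def tangle_coloring.simps by blast

lemma spanned_single [simp]: "spanned [p]"
  unfolding spanned_def tangle_coloring.simps by blast

lemma spanned_crossing_Cons: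
  fixes T :: "'d diagram"
  shows "spanned T \<Longrightarrow> spanned ((i, Cross b) # T)"
  unfolding spanned_def
proof (intro allI impI)
  fix s X t K
  assume T: "\<forall>s X t K. subrack K \<longrightarrow> tangle_coloring s T X t \<longrightarrow> set s \<subseteq> K \<longrightarrow> set t \<subseteq> K \<longrightarrow> X \<subseteq> K"
    and K: "subrack K" and col: "tangle_coloring s ((i, Cross b) # T) X t"
    and st: "set s \<subseteq> K" "set t \<subseteq> K"
  obtain m Y where m: "layer_coloring s (i, Cross b :: 'd piece) m" "tangle_coloring m T Y t" "X = set s \<union> Y"
    using col unfolding tangle_coloring.simps by blast
  have "set m \<subseteq> K" using crossing_coloring_subrack(1)[OF K m(1)] st(1) by blast
  hence "Y \<subseteq> K" using T K m(2) st(2) by blast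
  thus "X \<subseteq> K" using m(3) st(1) by blast
qed

lemma spanned_cup_crossing:
  fixes d :: 'd
  shows "spanned [(i, Cup d), (j, Cross b)]"
proof -
  have "X \<subseteq> K" if K: "subrack K" and col: "tangle_coloring s [(i, Cup d), (j, Cross b)] X t"
    and st: "set s \<subseteq> K" "set t \<subseteq> K" for s X t K
  proof -
    obtain m where m: "layer_coloring s (i, Cup d) m" "layer_coloring m (j, Cross b :: 'd piece) t"
        "X = set s \<union> (set m \<union> set t)"
      using col unfolding tangle_coloring.simps by blast
    have "set s \<subseteq> carrier G" using K st by (auto simp: subrack_def)
    hence "set m \<subseteq> carrier G" using m(1) layer_coloring_carrier by blast
    hence "set m \<subseteq> K" using crossing_coloring_subrack(2)[OF K m(2)] st(2) by blast
    thus ?thesis using m st by auto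
  qed
  thus ?thesis unfolding spanned_def by blast
qed

text \<open>
  A new minimum is harmless if one of its two legs survives to the next level.
\<close>

lemma spanned_cup_Cons:
  assumes "\<And>A B g t. length A = i \<Longrightarrow> g \<in> carrier G \<Longrightarrow>
    layer_coloring (A @ g # inv g # B) p t \<Longrightarrow> g \<in> set t \<or> inv g \<in> set t"
  shows "spanned [(i, Cup d), p]"
proof -
  have "X \<subseteq> K" if K: "subrack K" and col: "tangle_coloring s [(i, Cup d), p] X t"
    and st: "set s \<subseteq> K" "set t \<subseteq> K" for s X t K
  proof -
    obtain m where m: "layer_coloring s (i, Cup d) m" "layer_coloring m p t"
        "X = set s \<union> (set m \<union> set t)"
      using col unfolding tangle_coloring.simps by blast
    obtain A B g where g: "s = A @ B" "m = A @ g # inv g # B" "length A = i" "g \<in> carrier G"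
      using m(1) by (auto simp: layer_coloring_def)
    have "g \<in> K \<or> inv g \<in> K" using assms[OF g(3,4)] m(2) g(2) st(2) by blast
    moreover have "inv g \<in> K \<Longrightarrow> inv (inv g) \<in> K" "g \<in> K \<Longrightarrow> inv g \<in> K"
      using K unfolding subrack_def by blast+
    ultimately have "g \<in> K \<and> inv g \<in> K" using g(4) by auto
    thus ?thesis using m(3) g st by auto
  qed
  thus ?thesis unfolding spanned_def by blast
qed

lemma spanned_exchange:
  assumes "\<And>s m t. layer_coloring s p m \<Longrightarrow> layer_coloring m q t \<Longrightarrow> set m \<subseteq> set s \<union> set t"
  shows "spanned [p, q]"
  unfolding spanned_def tangle_coloring.simps using assms by blast

text \<open>
  If the second piece lies to the right of the first, the level splits into five parts, and each piece
  changes its own part only.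
\<close>

lemma distant_layers:
  assumes "layer_coloring s (i, e) m" "layer_coloring m (j, f) t" "i + strands_above e \<le> j"
  obtains A u v C u' v' B where "s = A @ u @ C @ u' @ B" "m = A @ v @ C @ u' @ B"
    "t = A @ v @ C @ v' @ B" "length A = i" "length (A @ v @ C) = j"
    "piece_coloring e u v" "piece_coloring f u' v'"
proof -
  obtain A u v D where e: "s = A @ u @ D" "m = A @ v @ D" "length A = i" "piece_coloring e u v"
    using assms(1) unfolding layer_coloring_def by auto
  obtain D' u' v' B where f: "m = D' @ u' @ B" "t = D' @ v' @ B" "length D' = j" "piece_coloring f u' v'"
    using assms(2) unfolding layer_coloring_def by auto
  have "length (A @ v) \<le> length D'" using e f assms(3) piece_coloring_length by fastforce
  moreover have "(A @ v) @ D = D' @ u' @ B" using e f by (simp only: append_assoc)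
  ultimately obtain C where C: "D' = A @ v @ C" "D = C @ u' @ B"
    by (auto simp: append_eq_append_conv2)
  have "s = A @ u @ C @ u' @ B" "m = A @ v @ C @ u' @ B" "t = A @ v @ C @ v' @ B"
    "length (A @ v @ C) = j"
    using e(1,2) f(1-3) unfolding C by (simp_all only: append_assoc)
  thus thesis using that e(3,4) f(4) by simp
qed

text \<open>
  The mirror case, with the right-hand piece below the left-hand one.
\<close>

lemma distant_layers':
  assumes "layer_coloring s (j, f) m" "layer_coloring m (i, e) t" "i + strands_below e \<le> j"
  obtains A u v C u' v' B where "s = A @ u @ C @ u' @ B" "m = A @ u @ C @ v' @ B"
    "t = A @ v @ C @ v' @ B" "length A = i" "length (A @ u @ C) = j"
    "piece_coloring e u v" "piece_coloring f u' v'"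
proof -
  obtain A u v D where e: "m = A @ u @ D" "t = A @ v @ D" "length A = i" "piece_coloring e u v"
    using assms(2) unfolding layer_coloring_def by auto
  obtain D' u' v' B where f: "s = D' @ u' @ B" "m = D' @ v' @ B" "length D' = j" "piece_coloring f u' v'"
    using assms(1) unfolding layer_coloring_def by auto
  have "length (A @ u) \<le> length D'" using e f assms(3) piece_coloring_length by fastforce
  moreover have "(A @ u) @ D = D' @ v' @ B" using e f by (simp only: append_assoc)
  ultimately obtain C where C: "D' = A @ u @ C" "D = C @ v' @ B"
    by (auto simp: append_eq_append_conv2)
  have "s = A @ u @ C @ u' @ B" "m = A @ u @ C @ v' @ B" "t = A @ v @ C @ v' @ B"
    "length (A @ u @ C) = j"
    using e(1,2) f(1-3) unfolding C by (simp_all only: append_assoc)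
  thus thesis using that e(3,4) f(4) by simp
qed

lemma layer_coloringI:
  "length A = i \<Longrightarrow> piece_coloring e u v \<Longrightarrow> layer_coloring (A @ u @ B) (i, e) (A @ v @ B)"
  unfolding layer_coloring_def by auto

lemma exchange_coloring:
  assumes "i + strands_above e \<le> j"
  shows "(\<exists>X. tangle_coloring s [(i, e), (j, f)] X t) \<longleftrightarrow>
     (\<exists>X. tangle_coloring s [(j - strands_above e + strands_below e, f), (i, e)] X t)"
    (is "?l \<longleftrightarrow> ?r")
proof
  assume ?l
  then obtain m where "layer_coloring s (i, e) m" "layer_coloring m (j, f) t"
    unfolding tangle_coloring.simps by blast
  then obtain A u v C u' v' B where
    *: "s = A @ u @ C @ u' @ B" "t = A @ v @ C @ v' @ B" "length A = i" "length (A @ v @ C) = j"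
      "piece_coloring e u v" "piece_coloring f u' v'"
    using assms by (rule distant_layers)
  have "layer_coloring s (j - strands_above e + strands_below e, f) (A @ u @ C @ v' @ B)"
  proof -
    have "length (A @ u @ C) = j - strands_above e + strands_below e"
      using *(3-5) piece_coloring_length[of e u v] by auto
    thus ?thesis using *(1,6) layer_coloringI[of "A @ u @ C" _ f u' v' B] by simp
  qed
  moreover have "layer_coloring (A @ u @ C @ v' @ B) (i, e) t"
    using * layer_coloringI[of A i e u v "C @ v' @ B"] by simp
  ultimately show ?r by auto
next
  assume ?r
  then obtain m where "layer_coloring s (j - strands_above e + strands_below e, f) m"
    "layer_coloring m (i, e) t"
    unfolding tangle_coloring.simps by blast
  moreover have "i + strands_below e \<le> j - strands_above e + strands_below e" using assms by simp
  ultimately obtain A u v C u' v' B where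
    *: "s = A @ u @ C @ u' @ B" "t = A @ v @ C @ v' @ B" "length A = i"
      "length (A @ u @ C) = j - strands_above e + strands_below e"
      "piece_coloring e u v" "piece_coloring f u' v'"
    by (rule distant_layers')
  have "layer_coloring s (i, e) (A @ v @ C @ u' @ B)"
    using * layer_coloringI[of A i e u v "C @ u' @ B"] by simp
  moreover have "layer_coloring (A @ v @ C @ u' @ B) (j, f) t"
    using * assms piece_coloring_length[of e u v] layer_coloringI[of "A @ v @ C" j f u' v' B] by simp
  ultimately show ?l by auto
qed

lemma spanned_local_move:
  assumes "local_move T T'"
  shows "spanned T" "spanned T'"
  using assms
proof (induction rule: local_move.induct)
  case (exchange i e j f)
  show "spanned [(i, e), (j, f)]"
  proof (rule spanned_exchange)
    fix s m t
    assume "layer_coloring s (i, e) m" "layer_coloring m (j, f) t"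
    thus "set m \<subseteq> set s \<union> set t" using exchange by (rule distant_layers) auto
  qed
  have j: "i + strands_below e \<le> j - strands_above e + strands_below e" using exchange by simp
  show "spanned [(j - strands_above e + strands_below e, f), (i, e)]"
  proof (rule spanned_exchange)
    fix s m t
    assume "layer_coloring s (j - strands_above e + strands_below e, f) m" "layer_coloring m (i, e) t"
    thus "set m \<subseteq> set s \<union> set t" using j by (rule distant_layers') auto
  qed
next
  case (zigzag_left i d)
  show "spanned [(i, Cup d), (i + 1, Cap)]"
  proof (rule spanned_cup_Cons)
    fix A B g t
    assume "length A = i" "g \<in> carrier G"
      and c: "layer_coloring (A @ g # inv g # B) (i + 1, Cap) t"
    moreover from this obtain x B' where "B = x # B'"
      by (cases B) (auto dest: layer_coloring_length)
    ultimately show "g \<in> set t \<or> inv g \<in> set t"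
      by (auto simp: layer_coloring_window)
  qed
next
  case (zigzag_right i d)
  show "spanned [(i + 1, Cup d), (i, Cap)]"
  proof (rule spanned_cup_Cons)
    fix A B g t
    assume A: "length A = i + 1" and g: "g \<in> carrier G"
      and c: "layer_coloring (A @ g # inv g # B) (i, Cap) t"
    obtain A' x where "A = A' @ [x]" "length A' = i"
      using A by (metis length_Suc_conv_rev Suc_eq_plus1)
    thus "g \<in> set t \<or> inv g \<in> set t"
      using c layer_coloring_window(3)[of A' x g "inv g # B" t] by auto
  qed
qed (simp_all add: spanned_crossing_Cons spanned_cup_crossing)

lemma ex_tangle_coloring:
  "(\<exists>X. tangle_coloring s (p # T) X t) \<longleftrightarrow> (\<exists>m. layer_coloring s p m \<and> (\<exists>X. tangle_coloring m T X t))"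
  by auto

lemma ex_tangle_coloring_Nil: "(\<exists>X. tangle_coloring s [] X t) \<longleftrightarrow> t = s"
  by auto

lemma obtain_window1:
  assumes "i < length s"
  obtains A x B where "s = A @ x # B" "i = length A"
  using assms that[of "take i s"] by (metis id_take_nth_drop length_take min.absorb4)

lemma obtain_window2:
  assumes "i + 1 < length s"
  obtains A x y B where "s = A @ x # y # B" "i = length A"
proof -
  obtain A x B where *: "s = A @ x # B" "i = length A" using assms by (auto intro: obtain_window1[of i s])
  moreover from this assms obtain y B' where "B = y # B'" by (cases B) auto
  ultimately show thesis using that by blast
qed

lemma obtain_window3:
  assumes "i + 2 < length s"
  obtains A x y z B where "s = A @ x # y # z # B" "i = length A"
proof -
  obtain A x y B where *: "s = A @ x # y # B" "i = length A" using assms by (auto intro: obtain_window2[of i s])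
  moreover from this assms obtain z B' where "B = z # B'" by (cases B) auto
  ultimately show thesis using that by blast
qed

text \<open>
  The two sides agree because conjugation is distributive over itself; the side condition on the crossings
  excludes exactly the two cyclic arrangements of the three strands, in which the computation fails.
\<close>

lemma braid_coloring:
  assumes "b = a \<or> b = c" "set s \<subseteq> carrier G"
  shows "(\<exists>X. tangle_coloring s [(i, Cross a), (i + 1, Cross b), (i, Cross c)] X t) =
         (\<exists>X. tangle_coloring s [(i + 1, Cross c), (i, Cross b), (i + 1, Cross a)] X t)"
proof (cases "i + 2 < length s")
  case True
  then obtain A x y z B where s: "s = A @ x # y # z # B" "i = length A"
    by (rule obtain_window3)
  show ?thesis
    using assms unfolding s(1,2)
    by (cases a; cases b; cases c)
       (simp_all add: ex_tangle_coloring ex_tangle_coloring_Nil layer_coloring_window m_assoc inv_mult_group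
         del: tangle_coloring.simps)
next
  case False
  then show ?thesis by (auto dest!: layer_coloring_length)
qed

lemma conj_eq_iff:
  assumes "x \<in> carrier G" "y \<in> carrier G" "z \<in> carrier G"
  shows "x \<otimes> (y \<otimes> inv x) = z \<longleftrightarrow> y = inv x \<otimes> (z \<otimes> x)"
    and "inv x \<otimes> (y \<otimes> x) = z \<longleftrightarrow> y = x \<otimes> (z \<otimes> inv x)"
  using assms by (auto simp: m_assoc)

lemma slide_cap_coloring:
  assumes "set s \<subseteq> carrier G"
  shows "(\<exists>X. tangle_coloring s [(i, Cross b), (i + 1, Cap)] X t) =
         (\<exists>X. tangle_coloring s [(i + 1, Cross (\<not> b)), (i, Cap)] X t)"
proof (cases "i + 2 < length s")
  case True
  then obtain A x y z B where s: "s = A @ x # y # z # B" "i = length A"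
    by (rule obtain_window3)
  show ?thesis
    using assms unfolding s(1,2)
    by (cases b)
       (auto simp: ex_tangle_coloring ex_tangle_coloring_Nil layer_coloring_window m_assoc inv_mult_group
         conj_eq_iff simp del: tangle_coloring.simps)
next
  case False
  then show ?thesis by (auto dest!: layer_coloring_length)
qed

text \<open>
  Here the color of the minimum has to change: on one side the minimum lies behind or in front
  of the sliding strand, so its colors differ by a conjugation from those on the other side.
\<close>

lemma slide_cup_coloring:
  assumes "set s \<subseteq> carrier G"
  shows "(\<exists>X. tangle_coloring s [(i + 1, Cup d), (i, Cross b)] X t) =
         (\<exists>X. tangle_coloring s [(i, Cup d), (i + 1, Cross (\<not> b))] X t)"
proof (cases "i < length s")
  case True
  then obtain A x B where s: "s = A @ x # B" "i = length A"
    by (rule obtain_window1)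
  have x: "x \<in> carrier G" using assms s by auto
  have 1: "(\<exists>X. tangle_coloring s [(i + 1, Cup d), (i, Cross b)] X t) \<longleftrightarrow>
     (\<exists>g\<in>carrier G. t = A @ strands (half_twist b (x, g)) @ inv g # B)"
    unfolding s by (auto simp: layer_coloring_window)
  have 2: "(\<exists>X. tangle_coloring s [(i, Cup d), (i + 1, Cross (\<not> b))] X t) \<longleftrightarrow>
     (\<exists>g\<in>carrier G. t = A @ g # strands (half_twist (\<not> b) (inv g, x)) @ B)"
    unfolding s by (auto simp: layer_coloring_window)
  have 3: "\<exists>h\<in>carrier G. strands (half_twist b (x, g)) @ inv g # B =
      h # strands (half_twist (\<not> b) (inv h, x)) @ B" if "g \<in> carrier G" for g
    using that x by (cases b) (auto simp: m_assoc inv_mult_group intro!: bexI[of _ "x \<otimes> (g \<otimes> inv x)"])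
  have 4: "\<exists>h\<in>carrier G. g # strands (half_twist (\<not> b) (inv g, x)) @ B =
      strands (half_twist b (x, h)) @ inv h # B" if "g \<in> carrier G" for g
    using that x
    by (cases b) (auto simp: m_assoc inv_mult_group intro!: bexI[of _ "inv x \<otimes> (g \<otimes> x)"])
  show ?thesis unfolding 1 2
  proof
    assume "\<exists>g\<in>carrier G. t = A @ strands (half_twist b (x, g)) @ inv g # B"
    then obtain g where g: "g \<in> carrier G" "t = A @ strands (half_twist b (x, g)) @ inv g # B"
      by (elim bexE)
    with 3[OF g(1)] show "\<exists>g\<in>carrier G. t = A @ g # strands (half_twist (\<not> b) (inv g, x)) @ B"
      by auto
  next
    assume "\<exists>g\<in>carrier G. t = A @ g # strands (half_twist (\<not> b) (inv g, x)) @ B"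
    then obtain g where g: "g \<in> carrier G" "t = A @ g # strands (half_twist (\<not> b) (inv g, x)) @ B"
      by (elim bexE)
    with 4[OF g(1)] show "\<exists>g\<in>carrier G. t = A @ strands (half_twist b (x, g)) @ inv g # B"
      by auto
  qed
next
  case False
  then show ?thesis by (auto dest!: layer_coloring_length)
qed

text \<open>
  Admissibility of the first two pieces provides enough strands to perform the left side when the
  right side is empty.
\<close>

lemma local_move_coloring:
  assumes "local_move T T'" "set s \<subseteq> carrier G"
    and "admissible \<sigma> (T ! 0)" "admissible (next_level \<sigma> (T ! 0)) (T ! 1)"
    and "length \<sigma> = length s"
  shows "(\<exists>X. tangle_coloring s T X t) = (\<exists>X. tangle_coloring s T' X t)"
  using assms
proof (induction rule: local_move.induct)
  case (exchange i e j f)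
  thus ?case using exchange_coloring by blast
next
  case (zigzag_left i d)
  hence "i < length s" by simp
  then obtain A x B where s: "s = A @ x # B" "i = length A"
    by (rule obtain_window1)
  show ?case using zigzag_left(1) unfolding s ex_tangle_coloring ex_tangle_coloring_Nil
    by (auto simp: layer_coloring_window)
next
  case (zigzag_right i d)
  hence "i < length s" by simp
  then obtain A x B where s: "s = A @ x # B" "i = length A"
    by (rule obtain_window1)
  have x: "x \<in> carrier G" using zigzag_right(1) s by simp
  have "(\<exists>m. layer_coloring (A @ x # B) (Suc (length A), Cup d) m \<and>
          layer_coloring m (length A, Cap :: bool piece) t) \<longleftrightarrow>
        (\<exists>g\<in>carrier G. layer_coloring (A @ x # g # inv g # B) (length A, Cap :: bool piece) t)"
    unfolding layer_coloring_window(2) by blast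
  also have "\<dots> \<longleftrightarrow> t = A @ x # B"
    using x by (auto simp: layer_coloring_window(3))
  finally show ?case unfolding s ex_tangle_coloring ex_tangle_coloring_Nil by simp
next
  case (reidemeister1_cap i b)
  hence "i + 1 < length s" by simp
  then obtain A x y B where s: "s = A @ x # y # B" "i = length A"
    by (rule obtain_window2)
  have xy: "x \<in> carrier G" "y \<in> carrier G" using reidemeister1_cap(1) s by simp_all
  have "x = inv (x \<otimes> y \<otimes> inv x) \<longleftrightarrow> x \<otimes> (y \<otimes> inv x) = inv x"
    using xy by (metis inv_closed inv_inv m_assoc m_closed)
  also have "\<dots> \<longleftrightarrow> y = inv x" using xy by (simp add: conj_eq_iff)
  finally have "inv (x \<otimes> y \<otimes> inv x) = x \<longleftrightarrow> y = inv x" by auto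
  moreover have "inv (inv y \<otimes> x \<otimes> y) = y \<longleftrightarrow> y = inv x"
    using xy by (simp add: m_assoc inv_mult_group conj_eq_iff) (metis inv_inv)
  ultimately have cap: "x = inv (x \<otimes> y \<otimes> inv x) \<longleftrightarrow> y = inv x"
    "inv y \<otimes> x \<otimes> y = inv y \<longleftrightarrow> y = inv x"
    using xy by (metis inv_closed inv_inv m_closed)+
  show ?case using xy cap unfolding s ex_tangle_coloring ex_tangle_coloring_Nil
    by (cases b) (auto simp: layer_coloring_window)
next
  case (reidemeister1_cup i d b)
  hence i: "i \<le> length s" by simp
  define A B where "A = take i s" and "B = drop i s"
  have s: "s = A @ B" "i = length A" using i by (auto simp: A_def B_def)
  have "(\<exists>g\<in>carrier G. t = A @ inv g # g # B) \<longleftrightarrow> (\<exists>g\<in>carrier G. t = A @ g # inv g # B)"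
    by (metis inv_closed inv_inv)
  thus ?case unfolding s ex_tangle_coloring ex_tangle_coloring_Nil
    by (cases b) (auto simp: layer_coloring_window m_assoc)
next
  case (reidemeister2 i b)
  hence "i + 1 < length s" by simp
  then obtain A x y B where s: "s = A @ x # y # B" "i = length A"
    by (rule obtain_window2)
  show ?case using reidemeister2(1) unfolding s ex_tangle_coloring ex_tangle_coloring_Nil
    by (cases b) (auto simp: layer_coloring_window m_assoc)
next
  case (slide_cap i b)
  then show ?case by (intro slide_cap_coloring)
next
  case (slide_cup i d b)
  then show ?case by (intro slide_cup_coloring)
next
  case (reidemeister3 b a c i)
  show ?case by (intro braid_coloring reidemeister3)
qed

end

text \<open>
  Orientedness, which speaks about all prefixes of a diagram, becomes accessible to induction on the list of layers
  by starting from an arbitrary level.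
\<close>

fun admissible_tangle :: "bool list \<Rightarrow> bool diagram \<Rightarrow> bool" where
  "admissible_tangle s [] \<longleftrightarrow> True"
| "admissible_tangle s (p # T) \<longleftrightarrow> admissible s p \<and> admissible_tangle (next_level s p) T"

lemma admissible_tangle_append:
  "admissible_tangle s (S @ T) \<longleftrightarrow>
     admissible_tangle s S \<and> admissible_tangle (foldl next_level s S) T"
  by (induction S arbitrary: s) auto

lemma admissible_tangle_nth:
  "admissible_tangle s D \<longleftrightarrow> (\<forall>h < length D. admissible (foldl next_level s (take h D)) (D ! h))"
  by (induction D arbitrary: s) (auto simp: All_less_Suc2)

lemma oriented_diagram_admissible:
  "oriented_diagram D \<longleftrightarrow> admissible_tangle [] D \<and> foldl next_level [] D = []"
  by (simp add: oriented_diagram_def level_def admissible_tangle_nth)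

lemma admissible_strands_below: "admissible s (i, e) \<Longrightarrow> i + strands_below e \<le> length s"
  by (cases e) auto

lemma length_next_level:
  "admissible s (i, e) \<Longrightarrow> length (next_level s (i, e)) + strands_below e = length s + strands_above e"
  by (cases e) auto

lemma next_level_left: "admissible s (i, e) \<Longrightarrow> j < i \<Longrightarrow> next_level s (i, e) ! j = s ! j"
  by (cases e) (auto simp: nth_append)

lemma next_level_right:
  "admissible s (i, e) \<Longrightarrow> i + strands_below e \<le> j \<Longrightarrow> j < length s \<Longrightarrow>
     next_level s (i, e) ! (j - strands_below e + strands_above e) = s ! j"
  by (cases e) (auto simp: nth_append dest!: le_Suc_ex)

lemma next_level_cup:
  assumes "admissible s (i, Cup d)"
  shows "next_level s (i, Cup d) ! i = d" "next_level s (i, Cup d) ! (i + 1) = (\<not> d)"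
  using assms by (auto simp: nth_append)

lemma next_level_cross:
  assumes "admissible s (i, Cross b)"
  shows "next_level s (i, Cross b) ! i = s ! (i + 1)" "next_level s (i, Cross b) ! (i + 1) = s ! i"
  using assms by (auto simp: nth_append)

lemma local_move_length: "local_move T T' \<Longrightarrow> 2 \<le> length T"
  by (induction rule: local_move.induct) auto

context group
begin

lemma tangle_coloring_length:
  assumes "tangle_coloring s T X t" "length s = length \<sigma>" "admissible_tangle \<sigma> T"
  shows "length t = length (foldl next_level \<sigma> T)"
  using assms
proof (induction T arbitrary: s \<sigma> X)
  case (Cons p T)
  obtain i e where p: "p = (i, e)" by (cases p)
  obtain m Y where m: "layer_coloring s (i, e) m" "tangle_coloring m T Y t"
    using Cons.prems(1) p by auto
  have "length m = length (next_level \<sigma> (i, e))"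
    using layer_coloring_length[OF m(1)] length_next_level[of \<sigma> i e] Cons.prems(2,3) p by simp
  with Cons.IH[OF m(2)] Cons.prems(3) p show ?case by simp
qed auto

text \<open>
  For two sets of colors this says that they generate the same subrack.
\<close>

definition same_subracks :: "'a set \<Rightarrow> 'a set \<Rightarrow> bool" where
  "same_subracks X Y \<longleftrightarrow> (\<forall>K. subrack K \<longrightarrow> (X \<subseteq> K \<longleftrightarrow> Y \<subseteq> K))"

lemma spannedD:
  assumes "spanned T" "tangle_coloring s T X t" "subrack K"
  shows "X \<subseteq> K \<longleftrightarrow> set s \<subseteq> K \<and> set t \<subseteq> K"
proof
  assume "X \<subseteq> K"
  thus "set s \<subseteq> K \<and> set t \<subseteq> K" using tangle_coloring_ends[OF assms(2)] by blast
next
  assume "set s \<subseteq> K \<and> set t \<subseteq> K"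
  thus "X \<subseteq> K" using assms unfolding spanned_def by blast
qed

lemma move_coloring:
  assumes "move D D' \<or> move D' D" "tangle_coloring [] D X []"
  shows "\<exists>X'. tangle_coloring [] D' X' [] \<and> same_subracks X X'"
proof -
  obtain A B S S' T T' where DD: "D = A @ S @ B" "D' = A @ S' @ B"
    and T: "local_move T T'" "(S, S') = (T, T') \<or> (S, S') = (T', T)"
    and or: "oriented_diagram (A @ T @ B)"
    using assms(1) unfolding move_def by blast
  from assms(2) obtain s X1 Y t X2 where A: "tangle_coloring [] A X1 s"
    and S: "tangle_coloring s S Y t" and B: "tangle_coloring t B X2 []"
    and X: "X = X1 \<union> (Y \<union> X2)"
    unfolding DD tangle_coloring_append by blast
  have s: "set s \<subseteq> carrier G"
    using tangle_coloring_carrier[OF A] tangle_coloring_ends[OF A] by auto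
  let ?\<sigma> = "foldl next_level [] A"
  have adm: "admissible_tangle [] A" "admissible_tangle ?\<sigma> T"
    using or by (auto simp: oriented_diagram_admissible admissible_tangle_append)
  obtain p q T0 where "T = p # q # T0"
    using local_move_length[OF T(1)] by (cases T; cases "tl T") auto
  hence "admissible ?\<sigma> (T ! 0)" "admissible (next_level ?\<sigma> (T ! 0)) (T ! 1)"
    using adm(2) by auto
  moreover have "length ?\<sigma> = length s" using tangle_coloring_length[OF A _ adm(1)] by simp
  ultimately have "(\<exists>Y. tangle_coloring s T Y t) = (\<exists>Y. tangle_coloring s T' Y t)"
    by (intro local_move_coloring[OF T(1) s])
  with S T(2) obtain Y' where Y': "tangle_coloring s S' Y' t" by blast
  have "spanned S" "spanned S'" using spanned_local_move[OF T(1)] T(2) by auto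
  hence "same_subracks (X1 \<union> (Y \<union> X2)) (X1 \<union> (Y' \<union> X2))"
    unfolding same_subracks_def using spannedD S Y' by simp blast
  moreover have "tangle_coloring [] D' (X1 \<union> (Y' \<union> X2)) []"
    unfolding DD tangle_coloring_append using A Y' B by blast
  ultimately show ?thesis using X by blast
qed

text \<open>
  The key invariance: any coloring of one diagram of a link gives a coloring of any other, and the generated
  subrack stays the same.  The number of colors does not.
\<close>

lemma link_coloring:
  assumes "D' \<in> link_of D" "tangle_coloring [] D X []"
  shows "\<exists>X'. tangle_coloring [] D' X' [] \<and> same_subracks X X'"
proof -
  have "equivclp move D D'" using assms(1) by (simp add: link_of_def)
  thus ?thesis
  proof (induction rule: equivclp_induct)
    case base
    show ?case using assms(2) by (auto simp: same_subracks_def)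
  next
    case (step E E')
    then obtain X' where X': "tangle_coloring [] E X' []" "same_subracks X X'" by blast
    from move_coloring[OF step.hyps(2) this(1)] obtain X'' where
      "tangle_coloring [] E' X'' []" "same_subracks X' X''" by blast
    with X'(2) show ?case unfolding same_subracks_def by blast
  qed
qed

lemma tangle_coloring_forget_orientation:
  "tangle_coloring s (forget_orientation D) X t \<longleftrightarrow> tangle_coloring s D X t"
proof (induction D arbitrary: s X)
  case (Cons p D)
  obtain i e where p: "p = (i, e)" by (cases p)
  have "piece_coloring (map_piece (\<lambda>_. ()) e) u v \<longleftrightarrow> piece_coloring e u v" for u v
    by (cases e) auto
  hence "layer_coloring s (i, map_piece (\<lambda>_. ()) e) m \<longleftrightarrow> layer_coloring s (i, e) m" for m
    by (simp add: layer_coloring_def)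
  with Cons p show ?case by (simp add: forget_orientation_def)
qed (simp add: forget_orientation_def)

text \<open>
  The passage from the recursive description to a function that assigns a list of colors to every level,
  as needed for the arcs of a diagram.
\<close>

lemma tangle_coloring_levels:
  "tangle_coloring s T X t \<longleftrightarrow>
     (\<exists>C. C 0 = s \<and> C (length T) = t \<and> (\<forall>h < length T. layer_coloring (C h) (T ! h) (C (h + 1))) \<and>
          X = (\<Union>h \<le> length T. set (C h)))"
proof (induction T arbitrary: s X)
  case Nil
  show ?case by (auto intro!: exI[of _ "\<lambda>_. s"])
next
  case (Cons p T)
  show ?case
  proof
    assume "tangle_coloring s (p # T) X t"
    then obtain m Y where m: "layer_coloring s p m" "tangle_coloring m T Y t" "X = set s \<union> Y"
      by auto
    then obtain C where C: "C 0 = m" "C (length T) = t"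
      "\<forall>h < length T. layer_coloring (C h) (T ! h) (C (h + 1))" "Y = (\<Union>h \<le> length T. set (C h))"
      unfolding Cons.IH by auto
    show "\<exists>C. C 0 = s \<and> C (length (p # T)) = t \<and>
        (\<forall>h < length (p # T). layer_coloring (C h) ((p # T) ! h) (C (h + 1))) \<and>
        X = (\<Union>h \<le> length (p # T). set (C h))"
    proof (intro exI[of _ "case_nat s C"] conjI)
      show "\<forall>h < length (p # T). layer_coloring (case_nat s C h) ((p # T) ! h) (case_nat s C (h + 1))"
        using m(1) C by (simp add: All_less_Suc2)
      show "X = (\<Union>h \<le> length (p # T). set (case_nat s C h))"
        using m(3) C(4) by (simp add: atMost_Suc_eq_insert_0 image_image)
    qed (use C in auto)
  next
    assume "\<exists>C. C 0 = s \<and> C (length (p # T)) = t \<and>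
        (\<forall>h < length (p # T). layer_coloring (C h) ((p # T) ! h) (C (h + 1))) \<and>
        X = (\<Union>h \<le> length (p # T). set (C h))"
    then obtain C where C: "C 0 = s" "C (Suc (length T)) = t"
      "\<forall>h < Suc (length T). layer_coloring (C h) ((p # T) ! h) (C (h + 1))"
      "X = (\<Union>h \<le> Suc (length T). set (C h))" by auto
    have "tangle_coloring (C 1) T (\<Union>h \<le> length T. set (C (Suc h))) t"
      unfolding Cons.IH using C(2,3)
      by (intro exI[of _ "\<lambda>h. C (Suc h)"]) (auto simp: All_less_Suc2)
    moreover have "layer_coloring s p (C 1)" using C(1,3) by auto
    moreover have "X = set s \<union> (\<Union>h \<le> length T. set (C (Suc h)))"
      using C(1,4) by (simp add: atMost_Suc_eq_insert_0 image_image)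
    ultimately show "tangle_coloring s (p # T) X t" by auto
  qed
qed

text \<open>
  Read strand by strand, the rule of a layer says that colors are constant along the segments of
  \<^const>\<open>joined\<close>, together with the condition of the piece itself.
\<close>

lemma layer_coloring_nth:
  "layer_coloring s (i, e) t \<longleftrightarrow>
     i + strands_below e \<le> length s \<and>
     length t + strands_below e = length s + strands_above e \<and>
     (\<forall>j < i. t ! j = s ! j) \<and>
     (\<forall>j. i + strands_below e \<le> j \<longrightarrow> j < length s \<longrightarrow>
        t ! (j - strands_below e + strands_above e) = s ! j) \<and>
     (case e of
        Cup d \<Rightarrow> t ! i \<in> carrier G \<and> t ! (i + 1) = inv (t ! i)
      | Cap \<Rightarrow> s ! i \<in> carrier G \<and> s ! (i + 1) = inv (s ! i)
      | Cross b \<Rightarrow> (t ! i, t ! (i + 1)) = half_twist b (s ! i, s ! (i + 1)))"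
  (is "?l \<longleftrightarrow> ?r")
proof
  assume ?l
  then obtain A B u v where *: "s = A @ u @ B" "t = A @ v @ B" "length A = i" "piece_coloring e u v"
    by (auto simp: layer_coloring_def)
  have "length u = strands_below e" "length v = strands_above e"
    using piece_coloring_length[OF *(4)] by auto
  moreover have "case e of
        Cup d \<Rightarrow> t ! i \<in> carrier G \<and> t ! (i + 1) = inv (t ! i)
      | Cap \<Rightarrow> s ! i \<in> carrier G \<and> s ! (i + 1) = inv (s ! i)
      | Cross b \<Rightarrow> (t ! i, t ! (i + 1)) = half_twist b (s ! i, s ! (i + 1))"
    using * by (cases e) (auto simp: nth_append strands_cases)
  ultimately show ?r using * by (auto simp: nth_append dest!: le_Suc_ex)
next
  assume r: ?r
  have len: "length t + strands_below e = length s + strands_above e" "i + strands_below e \<le> length s"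
    using r by blast+
  define A B u v where "A = take i s" and "B = drop (i + strands_below e) s"
    and "u = take (strands_below e) (drop i s)" and "v = take (strands_above e) (drop i t)"
  have A: "length A = i" using r by (simp add: A_def)
  have s: "s = A @ u @ B" by (simp add: A_def B_def u_def add.commute[of i] flip: drop_drop)
  have "take i t = A" unfolding A_def using r by (intro nth_equalityI) auto
  moreover have "drop (i + strands_above e) t = B"
  proof (rule nth_equalityI)
    show "length (drop (i + strands_above e) t) = length B" using len by (simp add: B_def)
    fix j assume "j < length (drop (i + strands_above e) t)"
    hence "t ! (i + strands_below e + j - strands_below e + strands_above e) = s ! (i + strands_below e + j)"
      using r by (intro r[THEN conjunct2, THEN conjunct2, THEN conjunct2, THEN conjunct1, rule_format]) auto
    thus "drop (i + strands_above e) t ! j = B ! j" using r by (simp add: B_def ac_simps)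
  qed
  ultimately have t: "t = A @ v @ B"
    by (metis append_take_drop_id drop_drop v_def add.commute)
  have two: "take 2 (drop i l) = [l ! i, l ! (i + 1)]" if "i + 2 \<le> length l" for l :: "'a list"
    using that by (intro nth_equalityI) (auto simp: less_2_cases_iff)
  have "piece_coloring e u v"
  proof (cases e)
    case (Cup d)
    thus ?thesis using r two[of t] by (auto simp: u_def v_def)
  next
    case Cap
    thus ?thesis using r two[of s] by (auto simp: u_def v_def)
  next
    case (Cross b)
    hence "u = strands (s ! i, s ! (i + 1))" "v = strands (half_twist b (s ! i, s ! (i + 1)))"
      using r two[of t] two[of s] by (auto simp: u_def v_def dest!: sym[of _ "half_twist _ _"])
    thus ?thesis using Cross piece_coloring.intros(3) by metis
  qed
  with s t A show ?l by (auto simp: layer_coloring_def)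
qed

end

section \<open>Colorings of arcs and colorings of levels\<close>

lemma level_Suc: "h < length D \<Longrightarrow> level D (Suc h) = next_level (level D h) (D ! h)"
  by (simp add: level_def take_Suc_conv_app_nth)

lemma admissible_level: "oriented_diagram D \<Longrightarrow> h < length D \<Longrightarrow> admissible (level D h) (D ! h)"
  by (simp add: oriented_diagram_def)

context group
begin

definition upward :: "bool \<Rightarrow> 'a \<Rightarrow> 'a" where
  "upward b g = (if b then g else inv g)"

lemma upward_closed [simp]: "g \<in> carrier G \<Longrightarrow> upward b g \<in> carrier G"
  by (simp add: upward_def)

lemma upward_upward [simp]: "g \<in> carrier G \<Longrightarrow> upward b (upward b g) = g"
  by (simp add: upward_def)

lemma upward_inv: "g \<in> carrier G \<Longrightarrow> upward (\<not> b) (inv g) = upward b g"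
  by (simp add: upward_def)

lemma inv_upward: "g \<in> carrier G \<Longrightarrow> inv (upward b g) = upward (\<not> b) g"
  by (simp add: upward_def)

lemma upward_in_inverse_closed:
  assumes "\<forall>g \<in> K. inv g \<in> K" "g \<in> carrier G"
  shows "upward b g \<in> K \<longleftrightarrow> g \<in> K"
  using assms unfolding upward_def by (metis inv_inv)

lemma upward_one_iff: "g \<in> carrier G \<Longrightarrow> upward b g = \<one> \<longleftrightarrow> g = \<one>"
  by (simp add: upward_def)

text \<open>
  The two cases of the crossing rule for positive and negative crossings become one rule for upward colors.
  Reversing the under strand exchanges its two ends and the sign and inverts both upward colors, so only the
  direction \<open>v\<close> of the over strand matters.
\<close>

lemma upward_crossing:
  assumes "x \<in> carrier G" "y \<in> carrier G" "z \<in> carrier G"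
  shows "upward u z = upward v x \<otimes> upward u y \<otimes> inv (upward v x) \<longleftrightarrow>
           (if v then x \<otimes> y = z \<otimes> x else x \<otimes> z = y \<otimes> x)"
    and "upward u z = inv (upward v x) \<otimes> upward u y \<otimes> upward v x \<longleftrightarrow>
           (if v then x \<otimes> z = y \<otimes> x else x \<otimes> y = z \<otimes> x)"
proof -
  have 1: "a = b \<otimes> c \<otimes> inv b \<longleftrightarrow> b \<otimes> c = a \<otimes> b" "a = inv b \<otimes> c \<otimes> b \<longleftrightarrow> b \<otimes> a = c \<otimes> b"
    if "a \<in> carrier G" "b \<in> carrier G" "c \<in> carrier G" for a b c
  proof -
    show "a = b \<otimes> c \<otimes> inv b \<longleftrightarrow> b \<otimes> c = a \<otimes> b"
      using that by (intro inv_solve_right) auto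
    have "a = inv b \<otimes> (c \<otimes> b) \<longleftrightarrow> c \<otimes> b = b \<otimes> a"
      using that by (intro inv_solve_left) auto
    thus "a = inv b \<otimes> c \<otimes> b \<longleftrightarrow> b \<otimes> a = c \<otimes> b" using that by (auto simp: m_assoc)
  qed
  have 2: "inv z = b \<otimes> inv y \<otimes> inv b \<longleftrightarrow> z = b \<otimes> y \<otimes> inv b" if "b \<in> carrier G" for b
  proof -
    have "b \<otimes> inv y \<otimes> inv b = inv (b \<otimes> y \<otimes> inv b)"
      using that assms by (simp add: inv_mult_group m_assoc)
    thus ?thesis using that assms by (metis inv_closed inv_inv m_closed)
  qed
  show "upward u z = upward v x \<otimes> upward u y \<otimes> inv (upward v x) \<longleftrightarrow>
           (if v then x \<otimes> y = z \<otimes> x else x \<otimes> z = y \<otimes> x)"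
    using assms 1[of z x y] 2[of x] 2[of "inv x"] by (cases u; cases v) (simp_all add: upward_def)
  show "upward u z = inv (upward v x) \<otimes> upward u y \<otimes> upward v x \<longleftrightarrow>
           (if v then x \<otimes> z = y \<otimes> x else x \<otimes> y = z \<otimes> x)"
    using assms 1[of z x y] 2[of x] 2[of "inv x"] by (cases u; cases v) (simp_all add: upward_def)
qed

text \<open>
  At a maximum or minimum the direction of the strand and its upward color are reversed simultaneously, so
  undoing the reversal gives a function that is constant on arcs.
\<close>

lemma joined_same_color:
  assumes D: "oriented_diagram D"
    and C: "\<And>h. h < length D \<Longrightarrow> layer_coloring (C h) (D ! h) (C (h + 1))"
    and c: "\<And>h j. c (h, j) = upward (level D h ! j) (C h ! j)"
    and len: "\<And>h. h \<le> length D \<Longrightarrow> length (C h) = length (level D h)"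
    and pq: "joined D p q"
  shows "c p = c q"
proof -
  note adm = admissible_level[OF D] and nxt = level_Suc[of _ D]
  show ?thesis using pq
  proof (induction rule: joined.induct)
    case (left h i e j)
    thus ?case using adm[of h] C[of h] nxt[of h]
      by (simp add: c next_level_left layer_coloring_nth del: next_level.simps)
  next
    case (right h i e j)
    thus ?case using adm[of h] C[of h] nxt[of h] next_level_right[of "level D h" i e j] len[of h]
      by (simp add: c layer_coloring_nth del: next_level.simps)
  next
    case (cup h i d)
    thus ?case using adm[of h] C[of h] nxt[of h] next_level_cup[of "level D h" i d]
      by (simp add: c layer_coloring_nth upward_inv del: next_level.simps)
  next
    case (cap h i)
    moreover from this have "level D h ! (i + 1) = (\<not> level D h ! i)" using adm[of h] by auto
    ultimately show ?case using C[of h]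
      by (simp add: c layer_coloring_nth upward_inv)
  next
    case (over_right h i)
    thus ?case using adm[of h] C[of h] nxt[of h] next_level_cross[of "level D h" i True]
      by (simp add: c layer_coloring_nth del: next_level.simps)
  next
    case (over_left h i)
    thus ?case using adm[of h] C[of h] nxt[of h] next_level_cross[of "level D h" i False]
      by (simp add: c layer_coloring_nth del: next_level.simps)
  qed
qed

end

interpretation S3: group S3
  by (rule sym_group_is_group)

\<comment> \<open>Inverses are computed in the group, not as inverse functions.\<close>
declare sym_group_inv_equality [simp del]

lemma crossing_points:
  assumes "oriented_diagram D" "h < length D" "D ! h = (i, Cross b)"
    and "k = h \<or> k = Suc h" "j = i \<or> j = Suc i"
  shows "(k, j) \<in> points D"
  using assms(2-) admissible_level[OF assms(1,2)] level_Suc[OF assms(2)] by (auto simp: points_def)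

definition upward_color :: "bool diagram \<Rightarrow> ((nat \<times> nat) set \<Rightarrow> nat \<Rightarrow> nat) \<Rightarrow> nat \<times> nat \<Rightarrow> nat \<Rightarrow> nat" where
  "upward_color D \<Gamma> p = S3.upward (level D (fst p) ! snd p) (\<Gamma> (arc_of D p))"

definition crossing_rule :: "bool diagram \<Rightarrow> ((nat \<times> nat) set \<Rightarrow> nat \<Rightarrow> nat) \<Rightarrow> nat \<Rightarrow> bool" where
  "crossing_rule D \<Gamma> h \<longleftrightarrow>
     (let x = over_arc D h; y = under_arc_before D h; z = under_arc_after D h in
         if positive D h then \<Gamma> x \<otimes>\<^bsub>S3\<^esub> \<Gamma> y = \<Gamma> z \<otimes>\<^bsub>S3\<^esub> \<Gamma> x
         else \<Gamma> x \<otimes>\<^bsub>S3\<^esub> \<Gamma> z = \<Gamma> y \<otimes>\<^bsub>S3\<^esub> \<Gamma> x)"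

lemma arc_of_joined: "joined D p q \<Longrightarrow> arc_of D p = arc_of D q"
proof -
  assume "joined D p q"
  hence "equivclp (joined D) p q" by (rule r_into_equivclp)
  thus ?thesis unfolding arc_of_def by (auto intro: equivclp_trans dest: equivclp_sym)
qed

lemma crossing_rule_upward:
  assumes D: "oriented_diagram D" and h: "h < length D" "D ! h = (i, Cross b)"
    and \<Gamma>: "\<Gamma> \<in> arcs D \<rightarrow> carrier S3"
  shows "crossing_rule D \<Gamma> h \<longleftrightarrow>
     (upward_color D \<Gamma> (h + 1, i), upward_color D \<Gamma> (h + 1, i + 1)) =
       S3.half_twist b (upward_color D \<Gamma> (h, i), upward_color D \<Gamma> (h, i + 1))"
proof -
  have adm: "admissible (level D h) (i, Cross b)"
    using admissible_level[OF D h(1)] h(2) by simp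
  have nxt: "level D (Suc h) = next_level (level D h) (i, Cross b)"
    using level_Suc[OF h(1)] h(2) by simp
  have lev: "level D (Suc h) ! i = level D h ! (Suc i)" "level D (Suc h) ! (Suc i) = level D h ! i"
    using next_level_cross[OF adm] nxt by simp_all
  have car: "\<Gamma> (arc_of D (k, j)) \<in> carrier S3" if "k = h \<or> k = Suc h" "j = i \<or> j = Suc i" for k j
    using \<Gamma> crossing_points[OF D h that] by (auto simp: arcs_def)
  show ?thesis
  proof (cases b)
    case True
    have "arc_of D (h, i) = arc_of D (Suc h, Suc i)"
      using arc_of_joined[OF joined.over_right[of h D i]] h True by simp
    thus ?thesis using True car S3.upward_crossing(1)[of "\<Gamma> (arc_of D (h, i))" "\<Gamma> (arc_of D (h, Suc i))" "\<Gamma> (arc_of D (Suc h, i))" "level D h ! (Suc i)" "level D h ! i"]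
      by (auto simp: crossing_rule_def Let_def positive_def over_arc_def under_arc_before_def
         under_arc_after_def under_upwards_def lower_under_arc_def upper_under_arc_def h lev
         upward_color_def split: if_splits)
  next
    case False
    have "arc_of D (h, Suc i) = arc_of D (Suc h, i)"
      using arc_of_joined[OF joined.over_left[of h D i]] h False by simp
    thus ?thesis using False car S3.upward_crossing(2)[of "\<Gamma> (arc_of D (h, Suc i))" "\<Gamma> (arc_of D (h, i))" "\<Gamma> (arc_of D (Suc h, Suc i))" "level D h ! i" "level D h ! Suc i"]
      by (auto simp: crossing_rule_def Let_def positive_def over_arc_def under_arc_before_def
         under_arc_after_def under_upwards_def lower_under_arc_def upper_under_arc_def h lev
         upward_color_def split: if_splits)
  qed
qed

lemma coloring_levels:
  assumes D: "oriented_diagram D" and col: "S3_coloring D \<Gamma>"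
  shows "S3.tangle_coloring [] D (upward_color D \<Gamma> ` points D) []"
proof -
  define C where "C h = map (\<lambda>j. upward_color D \<Gamma> (h, j)) [0..<length (level D h)]" for h
  note adm = admissible_level[OF D] and nxt = level_Suc[of _ D]
  have car: "\<Gamma> \<in> arcs D \<rightarrow> carrier S3" using col by (auto simp: S3_coloring_def)
  have "S3.layer_coloring (C h) (D ! h) (C (h + 1))" if h: "h < length D" for h
  proof -
    obtain i e where p: "D ! h = (i, e)" by (cases "D ! h")
    note adm = adm[OF h, unfolded p] and nxt = nxt[OF h, unfolded p]
    note below = admissible_strands_below[OF adm] and len = length_next_level[OF adm]
    have left: "C (Suc h) ! j = C h ! j" if "j < i" for j
      using that below len nxt next_level_left[OF adm that] arc_of_joined[OF joined.left[OF h p that]]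
      by (simp add: C_def upward_color_def)
    have right: "C (Suc h) ! (j - strands_below e + strands_above e) = C h ! j"
      if "i + strands_below e \<le> j" "j < length (level D h)" for j
      using that below len nxt next_level_right[OF adm that] arc_of_joined[OF joined.right[OF h p that]]
      by (simp add: C_def upward_color_def)
    have arc: "\<Gamma> (arc_of D (k, j)) \<in> carrier S3" if "k \<le> length D" "j < length (level D k)" for k j
      using that car by (auto simp: arcs_def points_def)
    have "case e of
        Cup d \<Rightarrow> C (Suc h) ! i \<in> carrier S3 \<and> C (Suc h) ! (i + 1) = inv\<^bsub>S3\<^esub> (C (Suc h) ! i)
      | Cap \<Rightarrow> C h ! i \<in> carrier S3 \<and> C h ! (i + 1) = inv\<^bsub>S3\<^esub> (C h ! i)
      | Cross b \<Rightarrow> (C (Suc h) ! i, C (Suc h) ! (i + 1)) = S3.half_twist b (C h ! i, C h ! (i + 1))"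
    proof (cases e)
      case (Cup d)
      thus ?thesis using len nxt below h arc[of "Suc h" i] next_level_cup[of "level D h" i d] adm
          arc_of_joined[OF joined.cup[OF h p[unfolded Cup]]]
        by (simp add: C_def upward_color_def S3.inv_upward del: next_level.simps upt_Suc)
    next
      case Cap
      moreover from this have "level D h ! (i + 1) = (\<not> level D h ! i)" using adm by auto
      ultimately show ?thesis using len nxt below h arc[of h i] adm
          arc_of_joined[OF joined.cap[OF h p[unfolded Cap]]]
        by (simp add: C_def upward_color_def S3.inv_upward del: next_level.simps upt_Suc)
    next
      case (Cross b)
      have "crossing_rule D \<Gamma> h" using col h p Cross
        by (simp add: S3_coloring_def crossing_rule_def crossing_at_def)
      thus ?thesis using crossing_rule_upward[OF D h p[unfolded Cross] car] len below nxt Cross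
        by (simp add: C_def del: upt_Suc)
    qed
    moreover have "length (C k) = length (level D k)" for k by (simp add: C_def)
    ultimately have "S3.layer_coloring (C h) (i, e) (C (Suc h))"
      unfolding S3.layer_coloring_nth using below len nxt left right by simp
    thus ?thesis by (simp add: p)
  qed
  moreover have "C 0 = []" "C (length D) = []"
    using D by (auto simp: C_def level_def oriented_diagram_def)
  moreover have "upward_color D \<Gamma> ` points D = (\<Union>h \<le> length D. set (C h))"
    by (force simp: C_def points_def)
  ultimately show ?thesis unfolding S3.tangle_coloring_levels by blast
qed

text \<open>
  The diagram is given as a composition of two tangles so that the colors at the level
  between them remain known.
\<close>

lemma levels_coloring:
  assumes D: "oriented_diagram (A @ B)"
    and col: "S3.tangle_coloring [] A Y m" "S3.tangle_coloring m B Z []"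
    and YZ: "Y \<union> Z \<subseteq> carrier S3 - {\<one>\<^bsub>S3\<^esub>}"
  obtains \<Gamma> where "S3_coloring (A @ B) \<Gamma>" "upward_color (A @ B) \<Gamma> ` points (A @ B) = Y \<union> Z"
    "\<And>j. j < length m \<Longrightarrow> upward_color (A @ B) \<Gamma> (length A, j) = m ! j"
proof -
  let ?D = "A @ B"
  obtain C1 where C1: "C1 0 = []" "C1 (length A) = m" "Y = (\<Union>h \<le> length A. set (C1 h))"
    "\<And>h. h < length A \<Longrightarrow> S3.layer_coloring (C1 h) (A ! h) (C1 (h + 1))"
    using col(1) unfolding S3.tangle_coloring_levels by blast
  obtain C2 where C2: "C2 0 = m" "C2 (length B) = []" "Z = (\<Union>h \<le> length B. set (C2 h))"
    "\<And>h. h < length B \<Longrightarrow> S3.layer_coloring (C2 h) (B ! h) (C2 (h + 1))"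
    using col(2) unfolding S3.tangle_coloring_levels by blast
  define C where "C h = (if h \<le> length A then C1 h else C2 (h - length A))" for h
  have C: "S3.layer_coloring (C h) (?D ! h) (C (h + 1))" if "h < length ?D" for h
  proof (cases "h < length A")
    case True
    thus ?thesis using C1(4)[OF True] by (simp add: C_def nth_append)
  next
    case False
    hence "C h = C2 (h - length A)" "C (h + 1) = C2 (h - length A + 1)"
      using C1(2) C2(1) by (auto simp: C_def Suc_diff_le)
    thus ?thesis using False that C2(4)[of "h - length A"] by (simp add: nth_append)
  qed
  have len: "length (C h) = length (level ?D h)" if "h \<le> length ?D" for h
    using that
  proof (induction h)
    case (Suc h)
    obtain i e where p: "?D ! h = (i, e)" by (cases "?D ! h")
    have "admissible (level ?D h) (?D ! h)" "level ?D (Suc h) = next_level (level ?D h) (?D ! h)"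
      using admissible_level[OF D] level_Suc[of h ?D] Suc.prems by auto
    with Suc C[of h] p S3.layer_coloring_length[of "C h" i e "C (h + 1)"] length_next_level[of "level ?D h" i e]
    show ?case by simp
  qed (simp add: C_def C1(1) level_def)
  define c where "c p = S3.upward (level ?D (fst p) ! snd p) (C (fst p) ! snd p)" for p
  \<comment> \<open>The function \<open>c\<close> is constant on arcs, so any point of an arc serves to define its color.\<close>
  define \<Gamma> where "\<Gamma> a = c (SOME p. p \<in> a)" for a
  have joined: "c p = c q" if "joined ?D p q" for p q
    by (rule S3.joined_same_color[OF D C _ len that]) (simp_all add: c_def)
  have c: "c p = c q" if "equivclp (joined ?D) p q" for p q
    using that by (induction rule: equivclp_induct) (auto dest: joined)
  have \<Gamma>: "\<Gamma> (arc_of ?D p) = c p" for p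
  proof -
    have "p \<in> arc_of ?D p" by (simp add: arc_of_def)
    hence "(SOME q. q \<in> arc_of ?D p) \<in> arc_of ?D p" by (rule someI)
    thus ?thesis using c by (simp add: \<Gamma>_def arc_of_def)
  qed
  have CYZ: "(\<Union>h \<le> length ?D. set (C h)) = Y \<union> Z"
  proof -
    have "{..length ?D} = {..length A} \<union> (+) (length A) ` {..length B}"
    proof (intro equalityI subsetI)
      fix h assume "h \<in> {..length ?D}"
      hence "h \<le> length A \<or> h = length A + (h - length A) \<and> h - length A \<in> {..length B}" by auto
      thus "h \<in> {..length A} \<union> (+) (length A) ` {..length B}" by blast
    qed auto
    moreover have "C (length A + h) = C2 h" for h using C1(2) C2(1) by (auto simp: C_def)
    moreover have "C h = C1 h" if "h \<le> length A" for h using that by (auto simp: C_def)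
    ultimately show ?thesis using C1(3) C2(3) by (simp add: UN_Un image_image)
  qed
  have CU: "C h ! j \<in> carrier S3 - {\<one>\<^bsub>S3\<^esub>}" if "(h, j) \<in> points ?D" for h j
  proof -
    have "h \<le> length ?D" "C h ! j \<in> set (C h)" using that len[of h] by (auto simp: points_def)
    hence "C h ! j \<in> Y \<union> Z" unfolding CYZ[symmetric] by blast
    thus ?thesis using YZ by blast
  qed
  have up: "upward_color ?D \<Gamma> (h, j) = C h ! j" if "(h, j) \<in> points ?D" for h j
    using CU[OF that] by (simp add: upward_color_def \<Gamma> c_def)
  have "\<Gamma> \<in> arcs ?D \<rightarrow> carrier S3 - {\<one>\<^bsub>S3\<^esub>}"
  proof -
    have "c p \<in> carrier S3 - {\<one>\<^bsub>S3\<^esub>}" if "p \<in> points ?D" for p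
      using CU[of "fst p" "snd p"] that by (simp add: c_def S3.upward_one_iff)
    thus ?thesis by (auto simp: arcs_def \<Gamma>)
  qed
  moreover have "crossing_rule ?D \<Gamma> h" if "crossing_at ?D h" for h
  proof -
    from that obtain i b where h: "h < length ?D" "?D ! h = (i, Cross b)"
      unfolding crossing_at_def by blast
    have lc: "S3.layer_coloring (C h) (i, Cross b :: bool piece) (C (h + 1))" using C[OF h(1)] h(2) by simp
    have "(h, i) \<in> points ?D" "(h, i + 1) \<in> points ?D"
      "(h + 1, i) \<in> points ?D" "(h + 1, i + 1) \<in> points ?D"
      using crossing_points[OF D h] by simp_all
    thus ?thesis using lc calculation
      by (subst crossing_rule_upward[OF D h]) (auto simp: up S3.layer_coloring_nth)
  qed
  ultimately have "S3_coloring ?D \<Gamma>"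
    unfolding S3_coloring_def crossing_rule_def by blast
  moreover have "upward_color ?D \<Gamma> ` points ?D = Y \<union> Z"
  proof -
    have "upward_color ?D \<Gamma> ` points ?D = (\<lambda>(h, j). C h ! j) ` points ?D"
      by (rule image_cong) (auto simp: up)
    also have "\<dots> = (\<Union>h \<le> length ?D. set (C h))"
      using len by (force simp: points_def in_set_conv_nth)
    finally show ?thesis using CYZ by simp
  qed
  moreover have "upward_color ?D \<Gamma> (length A, j) = m ! j" if "j < length m" for j
    using that up[of "length A" j] len[of "length A"] C1(2) by (simp add: C_def points_def)
  ultimately show thesis by (rule that)
qed

section \<open>Twist regions\<close>

definition twists_and_maxima :: "int \<Rightarrow> int \<Rightarrow> unit diagram" where
  "twists_and_maxima k l = replicate (nat \<bar>k\<bar>) (1, Cross (k < 0)) @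
     replicate (nat \<bar>l\<bar>) (0, Cross (l > 0)) @ [(1, Cap), (0, Cap)]"

lemma double_twist_split: "double_twist k l = [(0, Cup ()), (2, Cup ())] @ twists_and_maxima k l"
  by (simp add: double_twist_def twists_and_maxima_def)

context group
begin

text \<open>
  The colors along a twist region that is continued indefinitely in both directions.  A positive number of half
  twists moves forward along the sequence, a negative number moves backward, so one closed formula for
  such a sequence describes all twist regions with given initial colors.
\<close>

definition twist_sequence :: "(int \<Rightarrow> 'a \<times> 'a) \<Rightarrow> bool" where
  "twist_sequence F \<longleftrightarrow>
     (\<forall>n. F n \<in> carrier G \<times> carrier G \<and> half_twist False (F n) = F (n + 1))"

lemma half_twist_inverse:
  "p \<in> carrier G \<times> carrier G \<Longrightarrow> half_twist (\<not> b) (half_twist b p) = p"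
  by (cases b; cases p) (auto simp: m_assoc)

lemma twist_sequence_True: "twist_sequence F \<Longrightarrow> half_twist True (F n) = F (n - 1)"
  unfolding twist_sequence_def using half_twist_inverse[of "F (n - 1)" False]
  by (metis (no_types) diff_add_cancel)

lemma twist_region:
  assumes F: "twist_sequence F"
  shows "tangle_coloring (A @ strands (F m) @ B) (replicate n (length A, Cross b :: 'd piece)) X t \<Longrightarrow>
      t = A @ strands (F (if b then m - int n else m + int n)) @ B \<and>
      X \<subseteq> set A \<union> set B \<union> (\<Union>j. set (strands (F j)))"
    and "\<exists>X. tangle_coloring (A @ strands (F m) @ B) (replicate n (length A, Cross b :: 'd piece)) X
       (A @ strands (F (if b then m - int n else m + int n)) @ B)"
proof -
  have *: "layer_coloring (A @ strands (F m) @ B) (length A, Cross b :: 'd piece) t \<longleftrightarrow>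
      t = A @ strands (F (if b then m - 1 else m + 1)) @ B" for m t
  proof -
    obtain g h where "F m = (g, h)" by (cases "F m")
    moreover have "F (m + 1) = half_twist False (F m)" "F (m - 1) = half_twist True (F m)"
      using F twist_sequence_True[OF F, of m] by (simp_all add: twist_sequence_def)
    ultimately show ?thesis using layer_coloring_window(5)[of A g h B b t] by (cases b) simp_all
  qed
  show "tangle_coloring (A @ strands (F m) @ B) (replicate n (length A, Cross b :: 'd piece)) X t \<Longrightarrow>
      t = A @ strands (F (if b then m - int n else m + int n)) @ B \<and>
      X \<subseteq> set A \<union> set B \<union> (\<Union>j. set (strands (F j)))"
  proof (induction n arbitrary: m X)
    case (Suc n)
    then obtain Y where Y: "tangle_coloring (A @ strands (F (if b then m - 1 else m + 1)) @ B)
        (replicate n (length A, Cross b :: 'd piece)) Y t" "X = set (A @ strands (F m) @ B) \<union> Y"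
      unfolding replicate_Suc tangle_coloring.simps * by blast
    from Suc.IH[OF Y(1)] Y(2) show ?case by (cases b) (auto simp: algebra_simps)
  qed auto
  show "\<exists>X. tangle_coloring (A @ strands (F m) @ B) (replicate n (length A, Cross b :: 'd piece)) X
       (A @ strands (F (if b then m - int n else m + int n)) @ B)"
  proof (induction n arbitrary: m)
    case (Suc n)
    have "(if b then (if b then m - 1 else m + 1) - int n else (if b then m - 1 else m + 1) + int n) =
        (if b then m - int (Suc n) else m + int (Suc n))" by simp
    with Suc.IH[of "if b then m - 1 else m + 1"] show ?case
      unfolding replicate_Suc ex_tangle_coloring * by (simp only: simp_thms)
  qed auto
qed

lemma twist_region_int:
  assumes F: "twist_sequence F"
  shows "tangle_coloring (A @ strands (F m) @ B) (replicate (nat \<bar>k\<bar>) (length A, Cross (k < 0) :: 'd piece)) X t \<Longrightarrow>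
      t = A @ strands (F (m + k)) @ B \<and> X \<subseteq> set A \<union> set B \<union> (\<Union>j. set (strands (F j)))"
    and "\<exists>X. tangle_coloring (A @ strands (F m) @ B) (replicate (nat \<bar>k\<bar>) (length A, Cross (k < 0) :: 'd piece)) X
      (A @ strands (F (m + k)) @ B)"
proof -
  have k: "(if k < 0 then m - int (nat \<bar>k\<bar>) else m + int (nat \<bar>k\<bar>)) = m + k" by simp
  show "t = A @ strands (F (m + k)) @ B \<and> X \<subseteq> set A \<union> set B \<union> (\<Union>j. set (strands (F j)))"
    if "tangle_coloring (A @ strands (F m) @ B) (replicate (nat \<bar>k\<bar>) (length A, Cross (k < 0) :: 'd piece)) X t"
    using twist_region(1)[OF F that] unfolding k .
  show "\<exists>X. tangle_coloring (A @ strands (F m) @ B) (replicate (nat \<bar>k\<bar>) (length A, Cross (k < 0) :: 'd piece)) X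
      (A @ strands (F (m + k)) @ B)"
    using twist_region(2)[OF F, of A m B "nat \<bar>k\<bar>" "k < 0"] unfolding k .
qed

text \<open>
  Without minima no color enters the tangle except at its lower end.
\<close>

lemma tangle_coloring_no_cup:
  assumes "tangle_coloring s T X t" "subrack K" "set s \<subseteq> K" "\<forall>(i, e) \<in> set T. \<forall>d. e \<noteq> Cup d"
  shows "X \<subseteq> K"
  using assms
proof (induction T arbitrary: s X)
  case (Cons p T)
  obtain i e where p: "p = (i, e)" by (cases p)
  from Cons.prems(1) p obtain m Y where m: "layer_coloring s (i, e) m" "tangle_coloring m T Y t" "X = set s \<union> Y"
    by auto
  have "set m \<subseteq> K"
  proof (cases e)
    case (Cross b)
    thus ?thesis using crossing_coloring_subrack(1)[OF Cons.prems(2)] m(1) Cons.prems(3) by blast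
  next
    case (Cup d)
    thus ?thesis using Cons.prems(4) p by auto
  next
    case Cap
    thus ?thesis using m(1) Cons.prems(3) by (auto simp: layer_coloring_def)
  qed
  with Cons.IH[OF m(2)] Cons.prems m(3) show ?case by auto
qed auto

lemma minima_coloring:
  "tangle_coloring [] [(0, Cup d), (2, Cup d')] X s \<longleftrightarrow>
     (\<exists>g \<in> carrier G. \<exists>h \<in> carrier G. s = [g, inv g, h, inv h] \<and> X = {g, inv g, h, inv h})"
  by (auto simp: layer_coloring_cup_0 numeral_2_eq_2)

lemma maxima_coloring:
  "tangle_coloring [a, b, c, d] [(1, Cap), (0, Cap)] X [] \<longleftrightarrow>
     b \<in> carrier G \<and> c = inv b \<and> a \<in> carrier G \<and> d = inv a \<and> X = {a, b, c, d}"
  by (auto simp: layer_coloring_cap_0)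

text \<open>
  The second twist region starts with the left leg \<open>g\<close> of the first minimum and the left strand
  that leaves the first region.  The sign in \<open>m' - l\<close> comes from the opposite choice of crossings in
  the two regions of the diagram.
\<close>

lemma twists_and_maxima_coloring:
  assumes F: "twist_sequence F" "F m = (inv g, h)"
    and F': "twist_sequence F'" "F' m' = (g, fst (F (m + k)))"
  shows "tangle_coloring [g, inv g, h, inv h] (twists_and_maxima k l) X [] \<Longrightarrow>
      snd (F (m + k)) = inv (snd (F' (m' - l))) \<and> inv h = inv (fst (F' (m' - l))) \<and>
      set (strands (F (m + k))) \<subseteq> X \<and>
      X \<subseteq> {g, inv h} \<union> (\<Union>j. set (strands (F j))) \<union> (\<Union>j. set (strands (F' j)))"
    and "snd (F (m + k)) = inv (snd (F' (m' - l))) \<Longrightarrow> inv h = inv (fst (F' (m' - l))) \<Longrightarrow>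
      \<exists>X. tangle_coloring [g, inv g, h, inv h] (twists_and_maxima k l) X []"
proof -
  let ?K = "replicate (nat \<bar>k\<bar>) (length [g], Cross (k < 0)) :: unit diagram"
  let ?L = "replicate (nat \<bar>-l\<bar>) (length ([] :: 'a list), Cross (-l < 0)) :: unit diagram"
  let ?M = "[(1, Cap), (0, Cap)] :: unit diagram"
  obtain u v where uv: "F (m + k) = (u, v)" by (cases "F (m + k)")
  obtain p q where pq: "F' (m' - l) = (p, q)" by (cases "F' (m' - l)")
  have start: "[g, inv g, h, inv h] = [g] @ strands (F m) @ [inv h]" using F(2) by simp
  have middle: "[g] @ strands (F (m + k)) @ [inv h] = [] @ strands (F' m') @ [v, inv h]"
    using F'(2) uv by simp
  have T: "twists_and_maxima k l = ?K @ ?L @ ?M" by (simp add: twists_and_maxima_def)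
  have car: "p \<in> carrier G" "q \<in> carrier G" using F'(1) pq unfolding twist_sequence_def
    by (metis SigmaE2)+
  show "\<exists>X. tangle_coloring [g, inv g, h, inv h] (twists_and_maxima k l) X []"
    if "snd (F (m + k)) = inv (snd (F' (m' - l)))" "inv h = inv (fst (F' (m' - l)))"
  proof -
    obtain X1 where "tangle_coloring [g, inv g, h, inv h] ?K X1 ([g] @ strands (F (m + k)) @ [inv h])"
      unfolding start using twist_region_int(2)[OF F(1)] by blast
    moreover obtain X2 where "tangle_coloring ([g] @ strands (F (m + k)) @ [inv h]) ?L X2
        ([] @ strands (F' (m' - l)) @ [v, inv h])"
      unfolding middle using twist_region_int(2)[OF F'(1), of "[]" m' "[v, inv h]" "- l"] by auto
    moreover have "tangle_coloring ([] @ strands (F' (m' - l)) @ [v, inv h]) ?M {p, q, v, inv h} []"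
      using that uv pq car
      by (simp only: pq strands.simps append_Nil append_Cons maxima_coloring) simp
    ultimately show ?thesis unfolding T tangle_coloring_append by blast
  qed
  assume "tangle_coloring [g, inv g, h, inv h] (twists_and_maxima k l) X []"
  then obtain s t X1 X2 X3 where K: "tangle_coloring ([g] @ strands (F m) @ [inv h]) ?K X1 s"
    and L: "tangle_coloring s ?L X2 t" and M: "tangle_coloring t ?M X3 []" and X: "X = X1 \<union> (X2 \<union> X3)"
    unfolding T tangle_coloring_append start by blast
  have s: "s = [] @ strands (F' m') @ [v, inv h]"
    and X1: "X1 \<subseteq> {g, inv h} \<union> (\<Union>j. set (strands (F j)))" "set s \<subseteq> X1"
    using twist_region_int(1)[OF F(1) K] tangle_coloring_ends[OF K] middle by auto
  have t: "t = [p, q, v, inv h]" and X2: "X2 \<subseteq> {v, inv h} \<union> (\<Union>j. set (strands (F' j)))"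
    using twist_region_int(1)[OF F'(1) L[unfolded s]] pq by auto
  have M': "v = inv q" "inv h = inv p" "X3 = {p, q, v, inv h}"
    using M unfolding t maxima_coloring by auto
  have "v \<in> (\<Union>j. set (strands (F j)))" using uv by (intro UN_I[of "m + k"]) auto
  moreover have "{p, q} \<subseteq> (\<Union>j. set (strands (F' j)))" using pq by (intro subsetI UN_I[of "m' - l"]) auto
  moreover have "set (strands (F (m + k))) \<subseteq> X"
    using X1(2) X uv F'(2) unfolding s by auto
  ultimately show "snd (F (m + k)) = inv (snd (F' (m' - l))) \<and> inv h = inv (fst (F' (m' - l))) \<and>
      set (strands (F (m + k))) \<subseteq> X \<and>
      X \<subseteq> {g, inv h} \<union> (\<Union>j. set (strands (F j))) \<union> (\<Union>j. set (strands (F' j)))"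
    using X X1(1) X2 M' uv pq by auto
qed

end

section \<open>The symmetric group as a dihedral group\<close>

text \<open>
  The representative of an integer modulo 3 in \<open>{1..3}\<close>, the set on which \<^term>\<open>S3\<close> acts.
\<close>

definition residue :: "int \<Rightarrow> nat" where
  "residue z = nat ((z - 1) mod 3) + 1"

lemma residue_range: "residue z \<in> {1..3}"
proof -
  have "(z - 1) mod 3 < 3" "0 \<le> (z - 1) mod 3" by simp_all
  thus ?thesis unfolding residue_def by (auto simp: nat_le_iff)
qed

lemma int_residue: "int (residue z) = (z - 1) mod 3 + 1"
  by (simp add: residue_def)

lemma residue_eq_iff: "residue z = residue w \<longleftrightarrow> z mod 3 = w mod 3"
  unfolding of_nat_eq_iff[symmetric, where 'a = int] int_residue by presburger

lemma residue_int: "n \<in> {1..3} \<Longrightarrow> residue (int n) = n"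
  unfolding of_nat_eq_iff[symmetric, where 'a = int] int_residue by auto

lemma residue_add: "residue (w + int (residue z)) = residue (w + z)"
  and residue_diff: "residue (w - int (residue z)) = residue (w - z)"
  unfolding residue_eq_iff int_residue by presburger+

text \<open>
  Integers as parameters turn products of group elements into sums and equations into congruences
  modulo 3.
\<close>

definition rotation :: "int \<Rightarrow> nat \<Rightarrow> nat" where
  "rotation r n = (if n \<in> {1..3} then residue (int n + r) else n)"

definition reflection :: "int \<Rightarrow> nat \<Rightarrow> nat" where
  "reflection r n = (if n \<in> {1..3} then residue (r - int n) else n)"

lemma dihedral_mult [simp]:
  "rotation r \<otimes>\<^bsub>S3\<^esub> rotation r' = rotation (r + r')"
  "rotation r \<otimes>\<^bsub>S3\<^esub> reflection r' = reflection (r + r')"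
  "reflection r \<otimes>\<^bsub>S3\<^esub> rotation r' = reflection (r - r')"
  "reflection r \<otimes>\<^bsub>S3\<^esub> reflection r' = rotation (r - r')"
  using residue_range unfolding sym_group_mult
  by (auto simp: fun_eq_iff rotation_def reflection_def residue_add residue_diff algebra_simps)

lemma rotation_0: "rotation 0 = \<one>\<^bsub>S3\<^esub>"
  by (auto simp: fun_eq_iff rotation_def residue_int[unfolded atLeastAtMost_iff] sym_group_one)

lemma rotation_eq_iff [simp]: "rotation r = rotation r' \<longleftrightarrow> r mod 3 = r' mod 3"
proof
  assume "rotation r = rotation r'"
  hence "residue (1 + r) = residue (1 + r')" by (auto simp: fun_eq_iff rotation_def dest!: spec[of _ 1])
  thus "r mod 3 = r' mod 3" unfolding residue_eq_iff by presburger
next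
  assume "r mod 3 = r' mod 3"
  hence "residue (z + r) = residue (z + r')" for z unfolding residue_eq_iff by presburger
  thus "rotation r = rotation r'" by (simp add: fun_eq_iff rotation_def)
qed

lemma reflection_eq_iff [simp]: "reflection r = reflection r' \<longleftrightarrow> r mod 3 = r' mod 3"
proof
  assume "reflection r = reflection r'"
  hence "residue (r - 1) = residue (r' - 1)" by (auto simp: fun_eq_iff reflection_def dest!: spec[of _ 1])
  thus "r mod 3 = r' mod 3" unfolding residue_eq_iff by presburger
next
  assume "r mod 3 = r' mod 3"
  hence "residue (r - z) = residue (r' - z)" for z unfolding residue_eq_iff by presburger
  thus "reflection r = reflection r'" by (simp add: fun_eq_iff reflection_def)
qed

lemma rotation_neq_reflection [simp]: "rotation r \<noteq> reflection r'" "reflection r' \<noteq> rotation r"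
proof -
  show "rotation r \<noteq> reflection r'"
  proof
    assume *: "rotation r = reflection r'"
    from fun_cong[OF *, of 1] fun_cong[OF *, of 2]
    have "residue (1 + r) = residue (r' - 1)" "residue (2 + r) = residue (r' - 2)"
      by (simp_all add: rotation_def reflection_def)
    thus False unfolding residue_eq_iff by presburger
  qed
  thus "reflection r' \<noteq> rotation r" by metis
qed

lemma dihedral_carrier [simp]: "rotation r \<in> carrier S3" "reflection r \<in> carrier S3"
proof -
  have perm: "f \<in> carrier S3" if "\<And>n. n \<notin> {1..3} \<Longrightarrow> f n = n" "f \<circ> g = id" "g \<circ> f = id" for f g
  proof -
    have "bij f" using that(2,3) by (metis o_bij)
    hence "\<forall>y. \<exists>!x. f x = y" by (simp add: bij_iff)
    thus ?thesis using that(1) unfolding sym_group_carrier permutes_def by blast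
  qed
  show "rotation r \<in> carrier S3"
    using dihedral_mult(1)[of r "-r"] dihedral_mult(1)[of "-r" r]
    by (intro perm[of _ "rotation (-r)"]) (auto simp: rotation_def rotation_0 sym_group_mult sym_group_one)
  show "reflection r \<in> carrier S3"
    using dihedral_mult(4)[of r r]
    by (intro perm[of _ "reflection r"]) (auto simp: reflection_def rotation_0 sym_group_mult sym_group_one)
qed

lemma dihedral_inv [simp]:
  "inv\<^bsub>S3\<^esub> (rotation r) = rotation (- r)" "inv\<^bsub>S3\<^esub> (reflection r) = reflection r"
  by (rule S3.inv_equality; simp add: rotation_0)+

lemma carrier_S3: "carrier S3 = range rotation \<union> range reflection"
proof -
  have "finite (carrier S3)" "card (carrier S3) = 6"
    using sym_group_card_carrier[of 3] by (auto simp: fact_numeral intro: card_ge_0_finite)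
  moreover have "card (rotation ` {0, 1, 2} \<union> reflection ` {0, 1, 2}) = 6"
    by simp
  ultimately have "rotation ` {0, 1, 2} \<union> reflection ` {0, 1, 2} = carrier S3"
    by (intro card_subset_eq) auto
  hence "carrier S3 \<subseteq> range rotation \<union> range reflection" by blast
  thus ?thesis by (intro equalityI) (simp_all add: image_subset_iff)
qed

lemma carrier_S3_nontrivial:
  assumes "g \<in> carrier S3 - {\<one>\<^bsub>S3\<^esub>}"
  obtains i where "g = reflection i" | j where "g = rotation j" "j mod 3 \<noteq> 0"
  using assms unfolding carrier_S3 rotation_0[symmetric] by auto

section \<open>Colorings of the standard diagram\<close>

lemma subrack_nontrivial: "S3.subrack (carrier S3 - {\<one>\<^bsub>S3\<^esub>})"
  by (auto simp: S3.subrack_def carrier_S3 simp flip: rotation_0)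

lemma subrack_reflections: "S3.subrack (range reflection)"
  by (auto simp: S3.subrack_def)

lemma subrack_rotations: "S3.subrack (range rotation)"
  by (auto simp: S3.subrack_def)

lemma subrack_single_reflection: "S3.subrack {reflection i}"
  by (auto simp: S3.subrack_def)

text \<open>
  Conjugating one reflection by another extends an arithmetic progression by one term.
\<close>

definition reflection_twists :: "int \<Rightarrow> int \<Rightarrow> int \<Rightarrow> (nat \<Rightarrow> nat) \<times> (nat \<Rightarrow> nat)" where
  "reflection_twists i d n = (reflection (i + n * d), reflection (i + (n + 1) * d))"

lemma twist_sequence_reflections: "S3.twist_sequence (reflection_twists i d)"
  by (auto simp: S3.twist_sequence_def reflection_twists_def algebra_simps)

definition rotation_twists :: "int \<Rightarrow> int \<Rightarrow> int \<Rightarrow> (nat \<Rightarrow> nat) \<times> (nat \<Rightarrow> nat)" where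
  "rotation_twists r r' n = (if even n then (rotation r, rotation r') else (rotation r', rotation r))"

lemma twist_sequence_rotations: "S3.twist_sequence (rotation_twists r r')"
  by (auto simp: S3.twist_sequence_def rotation_twists_def)

text \<open>
  Conjugation by a reflection inverts the rotation, conjugation by a rotation moves the reflection.  After four
  half twists the rotation has been inverted twice, and the reflection has been moved by \<open>- 2 r\<close> and back.
\<close>

definition mixed_twists :: "int \<Rightarrow> int \<Rightarrow> int \<Rightarrow> (nat \<Rightarrow> nat) \<times> (nat \<Rightarrow> nat)" where
  "mixed_twists i r n =
     (if n mod 4 = 0 then (reflection i, rotation r)
      else if n mod 4 = 1 then (rotation r, reflection (i - 2 * r))
      else if n mod 4 = 2 then (reflection (i - 2 * r), rotation (- r))
      else (rotation (- r), reflection i))"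

lemma twist_sequence_mixed: "S3.twist_sequence (mixed_twists i r)"
proof -
  have "S3.half_twist False (mixed_twists i r n) = mixed_twists i r (n + 1)" for n
  proof -
    have "n mod 4 = 0 \<and> (n + 1) mod 4 = 1 \<or> n mod 4 = 1 \<and> (n + 1) mod 4 = 2 \<or>
        n mod 4 = 2 \<and> (n + 1) mod 4 = 3 \<or> n mod 4 = 3 \<and> (n + 1) mod 4 = 0" by presburger
    thus ?thesis by (elim disjE conjE) (simp_all add: mixed_twists_def algebra_simps)
  qed
  thus ?thesis by (auto simp: S3.twist_sequence_def mixed_twists_def)
qed

text \<open>
  A coloring of the standard diagram is given by the colors \<open>g\<close> and \<open>h\<close> of the two minima, subject to the condition
  of the inner maximum.
\<close>

lemma double_twist_cases:
  assumes "S3.tangle_coloring [] (double_twist k l) X []"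
  obtains g h where "g \<in> carrier S3" "h \<in> carrier S3" "g \<in> X" "h \<in> X"
    "\<And>K. S3.subrack K \<Longrightarrow> g \<in> K \<Longrightarrow> h \<in> K \<Longrightarrow> X \<subseteq> K"
    "\<And>F F' m m'. S3.twist_sequence F \<Longrightarrow> F m = (inv\<^bsub>S3\<^esub> g, h) \<Longrightarrow>
       S3.twist_sequence F' \<Longrightarrow> F' m' = (g, fst (F (m + k))) \<Longrightarrow>
       snd (F (m + k)) = inv\<^bsub>S3\<^esub> (snd (F' (m' - l)))"
proof -
  obtain s Y Z where Y: "S3.tangle_coloring [] [(0, Cup ()), (2, Cup ())] Y s"
    and Z: "S3.tangle_coloring s (twists_and_maxima k l) Z []" and X: "X = Y \<union> Z"
    using assms unfolding double_twist_split S3.tangle_coloring_append by blast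
  obtain g h where gh: "g \<in> carrier S3" "h \<in> carrier S3"
    and s: "s = [g, inv\<^bsub>S3\<^esub> g, h, inv\<^bsub>S3\<^esub> h]" "Y = {g, inv\<^bsub>S3\<^esub> g, h, inv\<^bsub>S3\<^esub> h}"
    using Y unfolding S3.minima_coloring by blast
  show thesis
  proof (rule that[OF gh])
    show "g \<in> X" "h \<in> X" using X s by auto
    show "X \<subseteq> K" if K: "S3.subrack K" "g \<in> K" "h \<in> K" for K
    proof -
      have "set s \<subseteq> K" using K s by (auto simp: S3.subrack_def)
      moreover have "\<forall>(i, e) \<in> set (twists_and_maxima k l). \<forall>d. e \<noteq> Cup d"
        by (auto simp: twists_and_maxima_def)
      ultimately have "Z \<subseteq> K" using S3.tangle_coloring_no_cup[OF Z K(1)] by blast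
      thus ?thesis using X s \<open>set s \<subseteq> K\<close> by auto
    qed
    fix F F' m m'
    assume "S3.twist_sequence F" "F m = (inv\<^bsub>S3\<^esub> g, h)"
       "S3.twist_sequence F'" "F' m' = (g, fst (F (m + k)))"
    from S3.twists_and_maxima_coloring(1)[OF this, of l Z] Z s(1)
    show "snd (F (m + k)) = inv\<^bsub>S3\<^esub> (snd (F' (m' - l)))" by simp
  qed
qed

text \<open>
  The first region takes the progression \<open>i, i + d\<close> to \<open>i + k d, i + (k + 1) d\<close>, so the second
  region starts with increment \<open>k d\<close>.  The inner maximum then requires \<open>(k l + 1) d = 0\<close> modulo 3.
\<close>

lemma reflections_double_twist:
  assumes "S3.tangle_coloring [] (double_twist k l) X []" "X \<subseteq> range reflection"
    and nonconstant: "\<And>i. \<not> X \<subseteq> {reflection i}"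
  shows "[k * l = 2] (mod 3)"
proof -
  obtain g h where gh: "g \<in> X" "h \<in> X" "\<And>K. S3.subrack K \<Longrightarrow> g \<in> K \<Longrightarrow> h \<in> K \<Longrightarrow> X \<subseteq> K"
    and F: "\<And>F F' m m'. S3.twist_sequence F \<Longrightarrow> F m = (inv\<^bsub>S3\<^esub> g, h) \<Longrightarrow>
       S3.twist_sequence F' \<Longrightarrow> F' m' = (g, fst (F (m + k))) \<Longrightarrow>
       snd (F (m + k)) = inv\<^bsub>S3\<^esub> (snd (F' (m' - l)))"
    using double_twist_cases[OF assms(1)] by metis
  obtain i j where ij: "g = reflection i" "h = reflection j" using gh(1,2) assms(2) by blast
  define d where "d = j - i"
  have "snd (reflection_twists i d (0 + k)) = inv\<^bsub>S3\<^esub> (snd (reflection_twists i (k * d) (0 - l)))"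
    by (rule F[OF twist_sequence_reflections _ twist_sequence_reflections])
       (simp_all add: reflection_twists_def ij d_def)
  hence "(i + (k + 1) * d) mod 3 = (i + (1 - l) * (k * d)) mod 3"
    by (simp add: reflection_twists_def)
  hence "3 dvd (i + (k + 1) * d) - (i + (1 - l) * (k * d))" by (rule mod_eq_dvd_iff[THEN iffD1])
  also have "(i + (k + 1) * d) - (i + (1 - l) * (k * d)) = (k * l + 1) * d" by (simp add: algebra_simps)
  finally have "3 dvd k * l + 1 \<or> 3 dvd d"
    using prime_dvd_mult_iff[of "3 :: int"] by (simp add: prime_int_numeral_eq)
  moreover have "\<not> 3 dvd d"
  proof
    assume "3 dvd d"
    hence "h = reflection i" unfolding ij d_def by simp presburger
    with gh(3)[OF subrack_single_reflection] ij nonconstant show False by blast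
  qed
  ultimately have "3 dvd k * l + 1" by blast
  thus ?thesis unfolding cong_def by presburger
qed

text \<open>
  Both kinds of colors occur, so the two minima have different kinds.  An even number of half twists in
  one of the regions would make a maximum join strands of different kinds.  If both numbers are odd, the
  period 4 of the mixed sequence reduces the condition of the inner maximum to finitely many cases.
\<close>

lemma mixed_double_twist:
  assumes "S3.tangle_coloring [] (double_twist k l) X []" "X \<subseteq> carrier S3 - {\<one>\<^bsub>S3\<^esub>}"
    and "\<not> X \<subseteq> range reflection" "\<not> X \<subseteq> range rotation"
  shows "[k * l = 3] (mod 4)"
proof -
  obtain g h where gh: "g \<in> X" "h \<in> X" "\<And>K. S3.subrack K \<Longrightarrow> g \<in> K \<Longrightarrow> h \<in> K \<Longrightarrow> X \<subseteq> K"
    and F: "\<And>F F' m m'. S3.twist_sequence F \<Longrightarrow> F m = (inv\<^bsub>S3\<^esub> g, h) \<Longrightarrow>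
       S3.twist_sequence F' \<Longrightarrow> F' m' = (g, fst (F (m + k))) \<Longrightarrow>
       snd (F (m + k)) = inv\<^bsub>S3\<^esub> (snd (F' (m' - l)))"
    using double_twist_cases[OF assms(1)] by metis
  have not_both: "\<not> (g \<in> range reflection \<and> h \<in> range reflection)"
    "\<not> (g \<in> range rotation \<and> h \<in> range rotation)"
    using gh(3)[OF subrack_reflections] gh(3)[OF subrack_rotations] assms(3,4) by blast+
  have nontriv: "g \<in> carrier S3 - {\<one>\<^bsub>S3\<^esub>}" "h \<in> carrier S3 - {\<one>\<^bsub>S3\<^esub>}"
    using gh(1,2) assms(2) by blast+
  have mod4: "[k * l = 3] (mod 4)" if "k mod 4 = 1 \<and> l mod 4 = 3 \<or> k mod 4 = 3 \<and> l mod 4 = 1"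
    using that mod_mult_eq[of k 4 l] unfolding cong_def by auto
  have k4: "k mod 4 = 0 \<or> k mod 4 = 1 \<or> k mod 4 = 2 \<or> k mod 4 = 3" by presburger
  have l4: "l mod 4 = 0 \<and> (-l) mod 4 = 0 \<and> (1 - l) mod 4 = 1 \<or> l mod 4 = 1 \<and> (-l) mod 4 = 3 \<and> (1 - l) mod 4 = 0
     \<or> l mod 4 = 2 \<and> (-l) mod 4 = 2 \<and> (1 - l) mod 4 = 3 \<or> l mod 4 = 3 \<and> (-l) mod 4 = 1 \<and> (1 - l) mod 4 = 2" by presburger
  show ?thesis
  proof (rule carrier_S3_nontrivial[OF nontriv(1)]; rule carrier_S3_nontrivial[OF nontriv(2)])
    fix i r assume g: "g = reflection i" and h: "h = rotation r" and r: "r mod 3 \<noteq> 0"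
    note F' = F[OF twist_sequence_mixed[of i r], of 0]
    from k4 show ?thesis
    proof (elim disjE)
      assume k: "k mod 4 = 0"
      from F'[OF _ twist_sequence_reflections[of i 0], of 0] show ?thesis
        by (simp add: mixed_twists_def reflection_twists_def g h k)
    next
      assume k: "k mod 4 = 2"
      from F'[OF _ twist_sequence_reflections[of i "- 2 * r"], of 0] show ?thesis
        by (simp add: mixed_twists_def reflection_twists_def g h k)
    next
      assume k: "k mod 4 = 1"
      have "snd (mixed_twists i r (0 + k)) = inv\<^bsub>S3\<^esub> snd (mixed_twists i r (0 - l))"
        by (rule F'[OF _ twist_sequence_mixed]) (simp_all add: mixed_twists_def g h k)
      hence "l mod 4 = 3" using r l4 by (auto simp: mixed_twists_def k) presburger+
      thus ?thesis using k mod4 by blast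
    next
      assume k: "k mod 4 = 3"
      have "snd (mixed_twists i r (0 + k)) = inv\<^bsub>S3\<^esub> snd (mixed_twists i (- r) (0 - l))"
        by (rule F'[OF _ twist_sequence_mixed]) (simp_all add: mixed_twists_def g h k)
      hence "l mod 4 = 1" using r l4 by (auto simp: mixed_twists_def k) presburger+
      thus ?thesis using k mod4 by blast
    qed
  next
    fix r i assume g: "g = rotation r" and r: "r mod 3 \<noteq> 0" and h: "h = reflection i"
    \<comment> \<open>The pair \<open>(rotation (- r), reflection i)\<close> of the inner legs is the entry of index 3.\<close>
    note F' = F[OF twist_sequence_mixed[of i r], of 3]
    have k3: "k mod 4 = 0 \<and> (3 + k) mod 4 = 3 \<or> k mod 4 = 1 \<and> (3 + k) mod 4 = 0 \<or>
       k mod 4 = 2 \<and> (3 + k) mod 4 = 1 \<or> k mod 4 = 3 \<and> (3 + k) mod 4 = 2" by presburger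
    from k3 show ?thesis
    proof (elim disjE conjE)
      assume k: "k mod 4 = 0" "(3 + k) mod 4 = 3"
      from F'[OF _ twist_sequence_rotations[of r "-r"], of 0] show ?thesis
        by (simp add: mixed_twists_def rotation_twists_def g h k split: if_splits)
    next
      assume k: "k mod 4 = 2" "(3 + k) mod 4 = 1"
      from F'[OF _ twist_sequence_rotations[of r r], of 0] show ?thesis
        by (simp add: mixed_twists_def rotation_twists_def g h k split: if_splits)
    next
      assume k: "k mod 4 = 1" "(3 + k) mod 4 = 0"
      \<comment> \<open>The second region starts at \<open>(rotation r, reflection i)\<close>, the entry of index 1 of the
        sequence with shifted reflection.\<close>
      have "snd (mixed_twists i r (3 + k)) = inv\<^bsub>S3\<^esub> snd (mixed_twists (i + 2 * r) r (1 - l))"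
        by (rule F'[OF _ twist_sequence_mixed]) (simp_all add: mixed_twists_def g h k)
      hence "l mod 4 = 3" using r l4 by (auto simp: mixed_twists_def k) presburger+
      thus ?thesis using k mod4 by blast
    next
      assume k: "k mod 4 = 3" "(3 + k) mod 4 = 2"
      have "snd (mixed_twists i r (3 + k)) = inv\<^bsub>S3\<^esub> snd (mixed_twists i r (1 - l))"
        by (rule F'[OF _ twist_sequence_mixed]) (simp_all add: mixed_twists_def g h k)
      hence "l mod 4 = 1" using r l4 by (auto simp: mixed_twists_def k) presburger+
      thus ?thesis using k mod4 by blast
    qed
  qed (use not_both in auto)
qed

section \<open>Necessity of the condition for four colors\<close>

lemma coloring_carrier: "S3_coloring D \<Gamma> \<Longrightarrow> p \<in> points D \<Longrightarrow> \<Gamma> (arc_of D p) \<in> carrier S3 - {\<one>\<^bsub>S3\<^esub>}"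
  unfolding S3_coloring_def arcs_def by blast

text \<open>
  A color and its upward color differ by an inversion at most.
\<close>

lemma upward_colors_subset:
  assumes "S3_coloring D \<Gamma>" "\<forall>g \<in> K. inv\<^bsub>S3\<^esub> g \<in> K"
  shows "upward_color D \<Gamma> ` points D \<subseteq> K \<longleftrightarrow> \<Gamma> ` arcs D \<subseteq> K"
proof -
  have "upward_color D \<Gamma> p \<in> K \<longleftrightarrow> \<Gamma> (arc_of D p) \<in> K" if "p \<in> points D" for p
    using coloring_carrier[OF assms(1) that] S3.upward_in_inverse_closed[OF assms(2)]
    by (simp add: upward_color_def)
  thus ?thesis by (simp add: arcs_def image_subset_iff)
qed

lemma link_of_sym: "D' \<in> link_of D \<Longrightarrow> D \<in> link_of D'"
  by (simp add: link_of_def equivclp_sym)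

lemma link_of_oriented:
  assumes "D' \<in> link_of D" "oriented_diagram D"
  shows "oriented_diagram D'"
proof -
  have "equivclp move D D'" using assms(1) by (simp add: link_of_def)
  thus ?thesis by (induction rule: equivclp_induct) (use assms(2) in \<open>auto simp: move_def\<close>)
qed

lemma double_twist_transfer:
  assumes "oriented_diagram D" "forget_orientation D = double_twist k l"
    and D': "D' \<in> link_of D" and X: "S3.tangle_coloring [] D' X []"
  obtains X' where "S3.tangle_coloring [] (double_twist k l) X' []" "S3.same_subracks X X'"
proof -
  obtain X' where "S3.tangle_coloring [] D X' []" "S3.same_subracks X X'"
    using S3.link_coloring[OF link_of_sym[OF D'] X] by blast
  thus thesis using that S3.tangle_coloring_forget_orientation[of "[]" D X' "[]"] assms(2) by simp
qed

lemma finite_dihedral: "range rotation = {rotation 0, rotation 1, rotation 2}"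
  "range reflection = {reflection 0, reflection 1, reflection 2}"
proof -
  have r: "r mod 3 = 0 mod 3 \<or> r mod 3 = 1 mod 3 \<or> r mod 3 = 2 mod 3" for r :: int by presburger
  show "range rotation = {rotation 0, rotation 1, rotation 2}"
    using r unfolding rotation_eq_iff[symmetric] by blast
  show "range reflection = {reflection 0, reflection 1, reflection 2}"
    using r unfolding reflection_eq_iff[symmetric] by blast
qed

lemma four_colors_necessary:
  assumes D: "oriented_diagram D" "forget_orientation D = double_twist k l"
    and col: "S3_colorable 4 (link_of D)"
  shows "[k * l = 3] (mod 4)"
proof -
  obtain D' \<Gamma> where D': "D' \<in> link_of D" and \<Gamma>: "S3_coloring D' \<Gamma>" "card (\<Gamma> ` arcs D') = 4"
    using col unfolding S3_colorable_def S3_n_coloring_def by blast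
  define X where "X = upward_color D' \<Gamma> ` points D'"
  have "S3.tangle_coloring [] D' X []"
    unfolding X_def by (rule coloring_levels[OF link_of_oriented[OF D' D(1)] \<Gamma>(1)])
  then obtain X' where X': "S3.tangle_coloring [] (double_twist k l) X' []" "S3.same_subracks X X'"
    by (rule double_twist_transfer[OF D D'])
  have same: "X' \<subseteq> K \<longleftrightarrow> \<Gamma> ` arcs D' \<subseteq> K" if "S3.subrack K" for K
    using X'(2) that upward_colors_subset[OF \<Gamma>(1), of K]
    by (simp add: S3.same_subracks_def X_def S3.subrack_def)
  have "\<Gamma> ` arcs D' \<subseteq> carrier S3 - {\<one>\<^bsub>S3\<^esub>}" using \<Gamma>(1) by (auto simp: S3_coloring_def)
  moreover have "\<not> \<Gamma> ` arcs D' \<subseteq> K" if "finite K" "card K \<le> 3" for K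
    using card_mono[OF that(1), of "\<Gamma> ` arcs D'"] that(2) \<Gamma>(2) by auto
  ultimately show ?thesis
    using same[OF subrack_nontrivial] same[OF subrack_reflections] same[OF subrack_rotations]
    by (intro mixed_double_twist[OF X'(1)]) (simp_all add: finite_dihedral)
qed

section \<open>Replacing three colors by the three reflections\<close>

text \<open>
  The flag \<open>p\<close> is the parity of the number of strands colored \<^term>\<open>reflection i\<close> that have been passed from the
  left; it selects one of the two other reflections.
\<close>

fun recolor :: "int \<Rightarrow> bool \<Rightarrow> (nat \<Rightarrow> nat) list \<Rightarrow> (nat \<Rightarrow> nat) list" where
  "recolor i p [] = []"
| "recolor i p (g # s) =
     (if g = reflection i then g # recolor i (\<not> p) s
      else reflection (if p then i + 1 else i - 1) # recolor i p s)"

fun parity_after :: "int \<Rightarrow> bool \<Rightarrow> (nat \<Rightarrow> nat) list \<Rightarrow> bool" where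
  "parity_after i p [] = p"
| "parity_after i p (g # s) = parity_after i (if g = reflection i then \<not> p else p) s"

lemma recolor_append: "recolor i p (s @ t) = recolor i p s @ recolor i (parity_after i p s) t"
  by (induction s arbitrary: p) auto

lemma parity_after_append: "parity_after i p (s @ t) = parity_after i (parity_after i p s) t"
  by (induction s arbitrary: p) auto

lemma length_recolor [simp]: "length (recolor i p s) = length s"
  by (induction s arbitrary: p) auto

text \<open>
  A strand of rotation color changes sides of a strand colored \<^term>\<open>reflection i\<close> only by passing under it.
  The parity to its left changes there, and so does its new color, as the crossing rule for reflections demands.
  The reversed situation, with the rotation strand above, would produce a second reflection.
\<close>

lemma recolor_piece:
  assumes "S3.piece_coloring e u v" "set u \<union> set v \<subseteq> {reflection i, rotation 1, rotation (- 1)}"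
  shows "S3.piece_coloring e (recolor i p u) (recolor i p v) \<and> parity_after i p u = parity_after i p v"
proof (cases e)
  case (Cross b)
  then obtain g h where gh: "u = [g, h]" "v = strands (S3.half_twist b (g, h))"
    using assms(1) by auto
  have "\<exists>q. recolor i p u = strands q \<and> recolor i p v = strands (S3.half_twist b q) \<and>
      parity_after i p u = parity_after i p v"
  proof (rule exI[of _ "(recolor i p u ! 0, recolor i p u ! 1)"])
    have g: "g = reflection i \<or> g = rotation 1 \<or> g = rotation (- 1)"
      and h: "h = reflection i \<or> h = rotation 1 \<or> h = rotation (- 1)"
      using gh assms(2) by auto
    have v: "set (strands (S3.half_twist b (g, h))) \<subseteq> {reflection i, rotation 1, rotation (- 1)}"
      using assms(2) gh(2) by simp
    have notin: "reflection (i + 2 * e) \<notin> {reflection i, rotation 1, rotation (- 1)}"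
      if "e = 1 \<or> e = - 1" for e
    proof -
      have "(i + 2 * e) mod 3 \<noteq> i mod 3" using that by presburger
      thus ?thesis by simp
    qed
    have over: "if b then g = reflection i \<or> h \<noteq> reflection i else h = reflection i \<or> g \<noteq> reflection i"
    proof (rule ccontr)
      assume "\<not> ?thesis"
      then consider e where "b" "g = rotation e" "h = reflection i" "e = 1 \<or> e = - 1"
        | e where "\<not> b" "h = rotation (- e)" "g = reflection i" "e = 1 \<or> e = - 1"
        using g h that(1)[of 1] that(1)[of "- 1"] that(2)[of 1] that(2)[of "- 1"] by (cases b) auto
      thus False
      proof cases
        case (1 e)
        hence "S3.half_twist b (g, h) = (reflection (i + 2 * e), rotation e)" by (simp add: algebra_simps)
        thus False using v notin[OF 1(4)] by simp
      next
        case (2 e)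
        hence "S3.half_twist b (g, h) = (rotation (- e), reflection (i + 2 * e))" by (simp add: algebra_simps)
        thus False using v notin[OF 2(4)] by simp
      qed
    qed
    show "recolor i p u = strands (recolor i p u ! 0, recolor i p u ! 1) \<and>
      recolor i p v = strands (S3.half_twist b (recolor i p u ! 0, recolor i p u ! 1)) \<and>
      parity_after i p u = parity_after i p v"
      unfolding gh using g h over
      by (cases b; elim disjE; cases p; simp add: ac_simps)
  qed
  thus ?thesis using Cross by auto
qed (use assms in auto)

lemma recolor_layer:
  assumes "S3.layer_coloring s P t" "set s \<union> set t \<subseteq> {reflection i, rotation 1, rotation (- 1)}"
  shows "S3.layer_coloring (recolor i p s) P (recolor i p t)"
proof -
  obtain A B u v where *: "s = A @ u @ B" "t = A @ v @ B" "length A = fst P"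
      "S3.piece_coloring (snd P) u v"
    using assms(1) unfolding S3.layer_coloring_def by blast
  let ?p = "parity_after i p A"
  have "S3.piece_coloring (snd P) (recolor i ?p u) (recolor i ?p v) \<and>
      parity_after i ?p u = parity_after i ?p v"
    by (rule recolor_piece) (use * assms(2) in auto)
  thus ?thesis unfolding S3.layer_coloring_def
    by (intro exI[of _ "recolor i p A"] exI[of _ "recolor i (parity_after i ?p u) B"]
        exI[of _ "recolor i ?p u"] exI[of _ "recolor i ?p v"])
      (simp add: * recolor_append parity_after_append)
qed

lemma set_recolor:
  "set (recolor i p s) \<subseteq> range reflection"
  "reflection i \<in> set s \<Longrightarrow> reflection i \<in> set (recolor i p s)"
  "\<not> set s \<subseteq> {reflection i} \<Longrightarrow> \<not> set (recolor i p s) \<subseteq> {reflection i}"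
proof (induction s arbitrary: p)
  case (Cons g s)
  { case 1 show ?case using Cons.IH(1) by auto }
  { case 2 thus ?case using Cons.IH(2) by auto }
  { case 3
    have "(i + 1) mod 3 \<noteq> i mod 3" "(i - 1) mod 3 \<noteq> i mod 3" by presburger+
    thus ?case using 3 Cons.IH(3) by auto }
qed auto

lemma recolor_tangle:
  assumes "S3.tangle_coloring s T X t" "X \<subseteq> {reflection i, rotation 1, rotation (- 1)}"
  shows "\<exists>X'. S3.tangle_coloring (recolor i p s) T X' (recolor i p t) \<and> X' \<subseteq> range reflection \<and>
    (reflection i \<in> X \<longrightarrow> reflection i \<in> X') \<and> (\<not> X \<subseteq> {reflection i} \<longrightarrow> \<not> X' \<subseteq> {reflection i})"
  using assms
proof (induction T arbitrary: s X)
  case Nil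
  thus ?case using set_recolor by fastforce
next
  case (Cons P T)
  then obtain m Y where m: "S3.layer_coloring s P m" "S3.tangle_coloring m T Y t" "X = set s \<union> Y"
    by auto
  from Cons.IH[OF m(2)] Cons.prems(2) m(3) obtain Y' where Y':
    "S3.tangle_coloring (recolor i p m) T Y' (recolor i p t)" "Y' \<subseteq> range reflection"
    "reflection i \<in> Y \<longrightarrow> reflection i \<in> Y'" "\<not> Y \<subseteq> {reflection i} \<longrightarrow> \<not> Y' \<subseteq> {reflection i}"
    by auto
  have "S3.layer_coloring (recolor i p s) P (recolor i p m)"
    using m(1) S3.tangle_coloring_ends[OF m(2)] m(3) Cons.prems(2) by (intro recolor_layer) auto
  hence "S3.tangle_coloring (recolor i p s) (P # T) (set (recolor i p s) \<union> Y') (recolor i p t)"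
    using Y'(1) by auto
  moreover have "set (recolor i p s) \<union> Y' \<subseteq> range reflection" using set_recolor(1) Y'(2) by blast
  moreover have "reflection i \<in> X \<longrightarrow> reflection i \<in> set (recolor i p s) \<union> Y'"
    using set_recolor(2) Y'(3) m(3) by blast
  moreover have "\<not> X \<subseteq> {reflection i} \<longrightarrow> \<not> set (recolor i p s) \<union> Y' \<subseteq> {reflection i}"
    using set_recolor(3)[of s i p] Y'(4) m(3) by blast
  ultimately show ?case by blast
qed

text \<open>
  Within the three colors \<open>a\<close>, \<open>b\<close>, \<open>t\<close> a crossing either leaves the under strand unchanged, with
  the same color above and below, or it exchanges \<open>a\<close> and \<open>b\<close> under \<open>t\<close>.  Any three
  distinct reflections in the place of \<open>a\<close>, \<open>b\<close>, \<open>t\<close> satisfy the same rules.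
\<close>

lemma recolor_rotation:
  assumes D: "oriented_diagram D" and col: "S3_coloring D \<Gamma>" and im: "\<Gamma> ` arcs D = {a, b, t}"
    and ab: "a \<in> range reflection" "b \<in> range reflection" "a \<noteq> b"
    and t: "t \<in> {rotation 1, rotation 2}"
  shows "\<exists>\<Gamma>'. S3_coloring D \<Gamma>' \<and> \<Gamma>' ` arcs D = range reflection"
proof -
  \<comment> \<open>The order of the three values is irrelevant: each reflection exchanges the other two.\<close>
  define f where "f g = (if g = a then reflection 0 else if g = b then reflection 1
    else reflection 2)" for g
  have "t \<noteq> a" "t \<noteq> b" using ab t by auto
  hence fQ: "f a = reflection 0" "f b = reflection 1" "f t = reflection 2"
    using ab(3) by (simp_all add: f_def)
  have f: "f x \<otimes>\<^bsub>S3\<^esub> f y = f z \<otimes>\<^bsub>S3\<^esub> f x"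
    if xyz: "x \<in> {a, b, t}" "y \<in> {a, b, t}" "z \<in> {a, b, t}" and eq: "x \<otimes>\<^bsub>S3\<^esub> y = z \<otimes>\<^bsub>S3\<^esub> x" for x y z
  proof -
    have "(if x = a then 0 else if x = b then 1 else 2 :: nat,
           if y = a then 0 else if y = b then 1 else 2 :: nat,
           if z = a then 0 else if z = b then 1 else 2 :: nat) \<in>
       {(0, 0, 0), (1, 1, 1), (2, 2, 2), (2, 0, 1), (2, 1, 0)}"
      using ab t xyz eq unfolding finite_dihedral
      by (elim insertE emptyE; hypsubst; simp)
    thus ?thesis using xyz by (auto simp: f_def split: if_splits)
  qed
  have "S3_coloring D (f \<circ> \<Gamma>)"
    unfolding S3_coloring_def
  proof (intro conjI allI impI)
    show "f \<circ> \<Gamma> \<in> arcs D \<rightarrow> carrier S3 - {\<one>\<^bsub>S3\<^esub>}"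
      by (auto simp: f_def simp flip: rotation_0)
    fix h assume h: "crossing_at D h"
    obtain i c where ib: "h < length D" "D ! h = (i, Cross c)" using h unfolding crossing_at_def by blast
    have "over_arc D h \<in> arcs D" "under_arc_before D h \<in> arcs D" "under_arc_after D h \<in> arcs D"
      using crossing_points[OF D ib]
      by (simp_all add: arcs_def over_arc_def under_arc_before_def under_arc_after_def
          lower_under_arc_def upper_under_arc_def ib)
    hence "\<Gamma> (over_arc D h) \<in> {a, b, t}" "\<Gamma> (under_arc_before D h) \<in> {a, b, t}" "\<Gamma> (under_arc_after D h) \<in> {a, b, t}"
      using im by blast+
    with col h show "let x = over_arc D h; y = under_arc_before D h; z = under_arc_after D h
          in if positive D h then (f \<circ> \<Gamma>) x \<otimes>\<^bsub>S3\<^esub> (f \<circ> \<Gamma>) y = (f \<circ> \<Gamma>) z \<otimes>\<^bsub>S3\<^esub> (f \<circ> \<Gamma>) x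
             else (f \<circ> \<Gamma>) x \<otimes>\<^bsub>S3\<^esub> (f \<circ> \<Gamma>) z = (f \<circ> \<Gamma>) y \<otimes>\<^bsub>S3\<^esub> (f \<circ> \<Gamma>) x"
      unfolding S3_coloring_def Let_def o_apply by (auto intro: f split: if_splits)
  qed
  moreover have "(f \<circ> \<Gamma>) ` arcs D = range reflection"
  proof -
    have "(f \<circ> \<Gamma>) ` arcs D = f ` {a, b, t}" unfolding image_comp[symmetric] im ..
    also have "\<dots> = range reflection" unfolding finite_dihedral by (simp add: fQ)
    finally show ?thesis .
  qed
  ultimately show ?thesis by blast
qed

lemma three_colors_reflections:
  assumes D: "oriented_diagram D" and col: "S3_coloring D \<Gamma>" and three: "card (\<Gamma> ` arcs D) = 3"
  shows "\<exists>X. S3.tangle_coloring [] D X [] \<and> X \<subseteq> range reflection \<and> (\<forall>i. \<not> X \<subseteq> {reflection i})"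
proof -
  have reflections: ?thesis
    if "S3_coloring D \<Gamma>'" "\<Gamma>' ` arcs D \<subseteq> range reflection" "card (\<Gamma>' ` arcs D) = 3" for \<Gamma>'
  proof -
    let ?X = "upward_color D \<Gamma>' ` points D"
    have "?X \<subseteq> range reflection"
      using upward_colors_subset[OF that(1), of "range reflection"] that(2) by auto
    moreover have "\<not> ?X \<subseteq> {reflection i}" for i
    proof
      assume "?X \<subseteq> {reflection i}"
      hence "\<Gamma>' ` arcs D \<subseteq> {reflection i}" using upward_colors_subset[OF that(1), of "{reflection i}"] by simp
      from card_mono[OF _ this] show False using that(3) by simp
    qed
    ultimately show ?thesis using coloring_levels[OF D that(1)] by blast
  qed
  define M where "M = \<Gamma> ` arcs D"
  have M: "M \<subseteq> range reflection \<union> {rotation 1, rotation 2}"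
  proof
    fix g assume "g \<in> M"
    hence "g \<in> carrier S3 - {\<one>\<^bsub>S3\<^esub>}" using col by (auto simp: S3_coloring_def M_def)
    thus "g \<in> range reflection \<union> {rotation 1, rotation 2}"
      unfolding carrier_S3 finite_dihedral(1) rotation_0[symmetric] by auto
  qed
  have fin: "finite M" using three by (auto intro: card_ge_0_finite simp: M_def)
  consider "M \<subseteq> range reflection"
    | t where "t \<in> {rotation 1, rotation 2}" "t \<in> M" "M - {t} \<subseteq> range reflection"
    | "rotation 1 \<in> M" "rotation 2 \<in> M"
    using M by blast
  thus ?thesis
  proof cases
    case 1
    thus ?thesis using reflections[OF col] three by (simp add: M_def)
  next
    case (2 t)
    hence "card (M - {t}) = 2" using three fin by (simp add: M_def)
    then obtain a b where ab: "M - {t} = {a, b}" "a \<noteq> b" by (auto simp: card_2_iff)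
    hence "M = {a, b, t}" using 2(2) by auto
    moreover have "a \<in> range reflection" "b \<in> range reflection" using 2(3) ab(1) by auto
    ultimately obtain \<Gamma>' where "S3_coloring D \<Gamma>'" "\<Gamma>' ` arcs D = range reflection"
      using recolor_rotation[OF D col _ _ _ ab(2) 2(1)] unfolding M_def by blast
    thus ?thesis using reflections[of \<Gamma>'] unfolding finite_dihedral by simp
  next
    case 3
    have "card (M - {rotation 1} - {rotation 2}) = 1" using 3 three fin by (simp add: M_def)
    then obtain a where a: "M - {rotation 1} - {rotation 2} = {a}" by (auto simp: card_1_singleton_iff)
    hence "a \<in> range reflection" using M by blast
    then obtain i where i: "a = reflection i" by blast
    have rot2: "rotation 2 = rotation (- 1)" by simp
    have "M = {a, rotation 1, rotation 2}" using a 3 by blast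
    hence Mi: "M = {reflection i, rotation 1, rotation (- 1)}" unfolding i rot2 .
    define X where "X = upward_color D \<Gamma> ` points D"
    have sub: "X \<subseteq> K \<longleftrightarrow> M \<subseteq> K" if "\<forall>g \<in> K. inv\<^bsub>S3\<^esub> g \<in> K" for K
      unfolding M_def X_def by (rule upward_colors_subset[OF col that])
    have XQ: "X \<subseteq> {reflection i, rotation 1, rotation (- 1)}" using sub[of "{reflection i, rotation 1, rotation (- 1)}"] Mi by simp
    have "\<not> X \<subseteq> {rotation 1, rotation (- 1)}" using sub[of "{rotation 1, rotation (- 1)}"] Mi by simp
    hence iX: "reflection i \<in> X" using XQ by blast
    have nX: "\<not> X \<subseteq> {reflection i}" using sub[of "{reflection i}"] Mi by simp
    from recolor_tangle[OF coloring_levels[OF D col, folded X_def] XQ, of True]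
    obtain X' where "S3.tangle_coloring (recolor i True []) D X' (recolor i True []) \<and>
      X' \<subseteq> range reflection \<and> (reflection i \<in> X \<longrightarrow> reflection i \<in> X') \<and>
      (\<not> X \<subseteq> {reflection i} \<longrightarrow> \<not> X' \<subseteq> {reflection i})"
      by (rule exE)
    note X' = this[unfolded recolor.simps, THEN conjunct1]
      this[THEN conjunct2, THEN conjunct1]
      this[THEN conjunct2, THEN conjunct2, THEN conjunct1, rule_format, OF iX]
      this[THEN conjunct2, THEN conjunct2, THEN conjunct2, rule_format, OF nX]
    have "\<not> X' \<subseteq> {reflection j}" for j
    proof
      assume j: "X' \<subseteq> {reflection j}"
      hence "reflection i \<in> {reflection j}" using X'(3) by (rule subsetD)
      hence "{reflection i} = {reflection j}" unfolding singleton_iff by (rule arg_cong)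
      thus False using X'(4) j by (simp only: simp_thms)
    qed
    thus ?thesis using X'(1,2) by (intro exI[of _ X'] conjI allI)
  qed
qed

text \<open>
  Non-constancy is expressed by the one-element subracks, and therefore survives on the standard diagram.
\<close>

lemma three_colors_necessary:
  assumes D: "oriented_diagram D" "forget_orientation D = double_twist k l"
    and col: "S3_colorable 3 (link_of D)"
  shows "[k * l = 2] (mod 3)"
proof -
  obtain D' \<Gamma> where D': "D' \<in> link_of D" and \<Gamma>: "S3_coloring D' \<Gamma>" "card (\<Gamma> ` arcs D') = 3"
    using col unfolding S3_colorable_def S3_n_coloring_def by blast
  obtain X where X: "S3.tangle_coloring [] D' X []" "X \<subseteq> range reflection" "\<And>i. \<not> X \<subseteq> {reflection i}"
    using three_colors_reflections[OF link_of_oriented[OF D' D(1)] \<Gamma>] by blast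
  obtain X' where X': "S3.tangle_coloring [] (double_twist k l) X' []" "S3.same_subracks X X'"
    using double_twist_transfer[OF D D' X(1)] by blast
  show ?thesis
    using X(2,3) X'(2) subrack_reflections subrack_single_reflection
    by (intro reflections_double_twist[OF X'(1)]) (auto simp: S3.same_subracks_def)
qed

section \<open>Existence of colorings\<close>

lemma double_twist_orientation:
  assumes "forget_orientation D = double_twist k l"
  obtains d d' R where "D = [(0, Cup d), (2, Cup d')] @ R" "forget_orientation R = twists_and_maxima k l"
proof -
  have cup: "\<exists>d. e = Cup d" if "map_piece (\<lambda>_. ()) e = Cup ()" for e :: "bool piece"
    using that by (cases e) auto
  from assms obtain p q R where "D = p # q # R" "map_prod id (map_piece (\<lambda>_. ())) p = (0, Cup ())"
    "map_prod id (map_piece (\<lambda>_. ())) q = (2, Cup ())" "forget_orientation R = twists_and_maxima k l"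
    unfolding double_twist_split forget_orientation_def by auto
  moreover from this obtain d d' where "p = (0, Cup d)" "q = (2, Cup d')"
    using cup by (cases p; cases q) fastforce
  ultimately show thesis using that by simp
qed

lemma double_twist_states:
  assumes D: "D = [(0, Cup d), (2, Cup d')] @ R" "forget_orientation R = twists_and_maxima k l"
    and gh: "g \<in> carrier S3" "h \<in> carrier S3"
    and F: "S3.twist_sequence F" "F m = (inv\<^bsub>S3\<^esub> g, h)"
    and F': "S3.twist_sequence F'" "F' m' = (g, fst (F (m + k)))"
    and closed: "snd (F (m + k)) = inv\<^bsub>S3\<^esub> (snd (F' (m' - l)))" "h = fst (F' (m' - l))"
  obtains X where "S3.tangle_coloring [g, inv\<^bsub>S3\<^esub> g, h, inv\<^bsub>S3\<^esub> h] R X []"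
    "set (strands (F (m + k))) \<subseteq> X"
    "X \<subseteq> {g, inv\<^bsub>S3\<^esub> h} \<union> (\<Union>j. set (strands (F j))) \<union> (\<Union>j. set (strands (F' j)))"
proof -
  obtain X where X: "S3.tangle_coloring [g, inv\<^bsub>S3\<^esub> g, h, inv\<^bsub>S3\<^esub> h] (twists_and_maxima k l) X []"
    using S3.twists_and_maxima_coloring(2)[OF F F', of l] closed by auto
  from S3.twists_and_maxima_coloring(1)[OF F F' this]
  show thesis using that X unfolding D(2)[symmetric] S3.tangle_coloring_forget_orientation by blast
qed

text \<open>
  The minima are colored with the reflections 0 and 1.  As \<open>k\<close> is not divisible by 3, one of the reflections
  \<open>k\<close> and \<open>k + 1\<close> at the end of the first twist region is the third color.
\<close>

lemma three_colors_sufficient: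
  assumes D: "oriented_diagram D" "forget_orientation D = double_twist k l"
    and kl: "[k * l = 2] (mod 3)"
  shows "S3_colorable 3 (link_of D)"
proof -
  obtain d d' R where R: "D = [(0, Cup d), (2, Cup d')] @ R" "forget_orientation R = twists_and_maxima k l"
    by (rule double_twist_orientation[OF D(2)])
  have kl3: "(k * l) mod 3 = 2" using kl by (simp add: cong_def)
  let ?F = "reflection_twists 0 1" and ?F' = "reflection_twists 0 k"
  have "(k + 1) mod 3 = (k - l * k) mod 3" "1 mod 3 = (- (l * k)) mod 3"
    using kl3 by (simp_all add: mult.commute[of l]) presburger+
  then obtain Z where Z: "S3.tangle_coloring [reflection 0, reflection 0, reflection 1, reflection 1] R Z []"
    "set (strands (?F (0 + k))) \<subseteq> Z"
    "Z \<subseteq> {reflection 0, reflection 1} \<union> (\<Union>j. set (strands (?F j))) \<union> (\<Union>j. set (strands (?F' j)))"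
    using double_twist_states[OF R, of "reflection 0" "reflection 1" ?F 0 ?F' 0]
      twist_sequence_reflections by (auto simp: reflection_twists_def algebra_simps)
  let ?Y = "{reflection 0, reflection 1}"
  have "S3.tangle_coloring [] [(0, Cup d), (2, Cup d')] ?Y [reflection 0, reflection 0, reflection 1, reflection 1]"
    unfolding S3.minima_coloring by (rule bexI[of _ "reflection 0"], rule bexI[of _ "reflection 1"]) auto
  moreover have YZ: "?Y \<union> Z \<subseteq> range reflection"
    using Z(3) by (auto simp: reflection_twists_def)
  hence "?Y \<union> Z \<subseteq> carrier S3 - {\<one>\<^bsub>S3\<^esub>}" by (auto simp flip: rotation_0)
  ultimately obtain \<Gamma> where \<Gamma>: "S3_coloring D \<Gamma>" "upward_color D \<Gamma> ` points D = ?Y \<union> Z"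
    using levels_coloring[OF D(1)[unfolded R(1)] _ Z(1), folded R(1), of ?Y thesis] by simp
  have sub: "\<Gamma> ` arcs D \<subseteq> K \<longleftrightarrow> ?Y \<union> Z \<subseteq> K" if "K \<subseteq> range reflection" for K
  proof -
    have "\<forall>g \<in> K. inv\<^bsub>S3\<^esub> g \<in> K" using that by (auto dest!: subsetD)
    from upward_colors_subset[OF \<Gamma>(1) this] show ?thesis unfolding \<Gamma>(2) by blast
  qed
  have "k mod 3 \<noteq> 0" using kl3 mod_mult_eq[of k 3 l] by auto
  hence "k mod 3 = 2 \<or> (k + 1) mod 3 = 2" by presburger
  hence "reflection k = reflection 2 \<or> reflection (k + 1) = reflection 2" by simp
  moreover have "reflection k \<in> Z" "reflection (k + 1) \<in> Z"
    using Z(2) by (auto simp: reflection_twists_def)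
  ultimately have "reflection 2 \<in> Z" by metis
  hence "range reflection \<subseteq> ?Y \<union> Z" unfolding finite_dihedral by blast
  moreover have "\<Gamma> ` arcs D \<subseteq> range reflection" using sub[of "range reflection"] YZ by simp
  moreover from this have "?Y \<union> Z \<subseteq> \<Gamma> ` arcs D" using sub[of "\<Gamma> ` arcs D"] by simp
  ultimately have "\<Gamma> ` arcs D = range reflection" by (metis subset_antisym subset_trans)
  hence "card (\<Gamma> ` arcs D) = 3" unfolding finite_dihedral by simp
  moreover have "D \<in> link_of D" by (simp add: link_of_def)
  ultimately show ?thesis using \<Gamma>(1) unfolding S3_colorable_def S3_n_coloring_def by blast
qed

lemma insert_reidemeister2:
  fixes b :: bool
  assumes D: "oriented_diagram D" "D = [(0, Cup d), (2, Cup d')] @ R"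
  defines "D' \<equiv> [(0, Cup d), (2, Cup d')] @ [(1, Cross b), (1, Cross (\<not> b))] @ R"
  shows "oriented_diagram D'" "D' \<in> link_of D"
proof -
  show or: "oriented_diagram D'"
    using D(1) unfolding D(2) D'_def oriented_diagram_admissible
    by (simp add: admissible_tangle_append numeral_2_eq_2)
  have "local_move [(1, Cross b), (1, Cross (\<not> b))] []" by (rule local_move.reidemeister2)
  hence "move D' D" unfolding move_def using or D D'_def
    by (intro conjI exI[of _ "[(0, Cup d), (2, Cup d')]"] exI[of _ R] exI) auto
  hence "equivclp move D' D" by (rule r_into_equivclp)
  thus "D' \<in> link_of D" by (simp add: link_of_def equivclp_sym)
qed

lemma opposite_rotations:
  assumes "x \<in> carrier S3" "y \<in> carrier S3"
    and "S3.upward b x = rotation r" "S3.upward b y = rotation (- r)"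
  shows "{rotation r, rotation (- r)} = {x, y}"
proof -
  have "x = S3.upward b (rotation r)" "y = S3.upward b (rotation (- r))"
    using assms by (metis S3.upward_upward)+
  thus ?thesis by (auto simp: S3.upward_def)
qed

lemma mixed_colors:
  "(\<Union>n. set (strands (mixed_twists i r n))) \<subseteq>
     {reflection i, reflection (i - 2 * r), rotation r, rotation (- r)}"
  by (auto simp: mixed_twists_def split: if_splits)

text \<open>
  If \<open>b\<close>, the reflection is on the first minimum and the rotation on the second; otherwise they are exchanged.
  In both cases \<open>b\<close> is the type of crossing in which the reflection strand passes over.  The indices
  \<open>m\<close> and \<open>m'\<close> are the positions at which the two twist regions start in the sequence \<open>mixed_twists 0 1\<close>,
  whose four pairs involve two reflections and two rotations only.
\<close>

lemma four_colors_diagram: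
  fixes b :: bool
  defines "F \<equiv> mixed_twists 0 1" and "Q \<equiv> {reflection 0, reflection (- 2), rotation 1, rotation (- 1)}"
  assumes D: "oriented_diagram D" "forget_orientation D = double_twist k l"
    and gh: "(b, m, m', g, h) \<in> {(True, 0, 0, reflection 0, rotation 1), (False, 3, 1, rotation 1, reflection 0)}"
    and F: "F m' = (g, fst (F (m + k)))" "reflection (- 2) \<in> set (strands (F (m + k)))"
    and closed: "snd (F (m + k)) = inv\<^bsub>S3\<^esub> (snd (F (m' - l)))" "h = fst (F (m' - l))"
  shows "S3_colorable 4 (link_of D)"
proof -
  obtain d d' R where R: "D = [(0, Cup d), (2, Cup d')] @ R" "forget_orientation R = twists_and_maxima k l"
    by (rule double_twist_orientation[OF D(2)])
  let ?A = "[(0, Cup d), (2, Cup d')]" and ?B = "[(1, Cross b), (1, Cross (\<not> b))] @ R"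
  let ?D = "?A @ ?B" and ?s = "[g, inv\<^bsub>S3\<^esub> g, h, inv\<^bsub>S3\<^esub> h]"
  note D' = insert_reidemeister2[OF D(1) R(1), of b]
  have ghc: "g \<in> carrier S3" "h \<in> carrier S3" using gh by auto
  have Fm: "F m = (inv\<^bsub>S3\<^esub> g, h)" using gh by (auto simp: F_def mixed_twists_def)
  have seq: "S3.twist_sequence F" unfolding F_def by (rule twist_sequence_mixed)
  have FQ: "(\<Union>j. set (strands (F j))) \<subseteq> Q" unfolding F_def Q_def using mixed_colors[of 0 1] by simp
  have sQ: "set ?s \<subseteq> Q" using gh by (auto simp: Q_def)
  obtain Z where Z: "S3.tangle_coloring ?s R Z []" "set (strands (F (m + k))) \<subseteq> Z" "Z \<subseteq> Q"
  proof -
    obtain Z where Z: "S3.tangle_coloring ?s R Z []" "set (strands (F (m + k))) \<subseteq> Z"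
      "Z \<subseteq> {g, inv\<^bsub>S3\<^esub> h} \<union> (\<Union>j. set (strands (F j))) \<union> (\<Union>j. set (strands (F j)))"
      by (rule double_twist_states[OF R ghc seq Fm seq F(1) closed])
    have "{g, inv\<^bsub>S3\<^esub> h} \<subseteq> Q" using sQ by simp
    hence "Z \<subseteq> Q" using Z(3) FQ by blast
    with Z(1,2) show thesis by (rule that)
  qed
  define m1 where "m1 = (if b then m - 1 else m + 1)"
  let ?s1 = "[g] @ strands (F m1) @ [inv\<^bsub>S3\<^esub> h]"
  have s: "?s = [g] @ strands (F m) @ [inv\<^bsub>S3\<^esub> h]" using Fm by simp
  have twist: "S3.layer_coloring ?s (1, Cross b :: bool piece) ?s1"
    "S3.layer_coloring ?s1 (1, Cross (\<not> b) :: bool piece) ?s"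
  proof -
    have "S3.half_twist b (F m) = F m1" "S3.half_twist (\<not> b) (F m1) = F m"
      using seq S3.twist_sequence_True[OF seq] by (auto simp: m1_def S3.twist_sequence_def)
    thus "S3.layer_coloring ?s (1, Cross b :: bool piece) ?s1"
      "S3.layer_coloring ?s1 (1, Cross (\<not> b) :: bool piece) ?s"
      unfolding s by (simp_all add: strands_cases S3.layer_coloring_cross_0)
  qed
  define Z1 where "Z1 = set ?s \<union> (set ?s1 \<union> Z)"
  have "S3.tangle_coloring ?s1 ((1, Cross (\<not> b)) # R) (set ?s1 \<union> Z) []"
    unfolding S3.tangle_coloring.simps(2) by (intro exI conjI) (rule twist(2), rule Z(1), rule refl)
  hence "S3.tangle_coloring ?s ((1, Cross b) # (1, Cross (\<not> b)) # R) Z1 []"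
    unfolding S3.tangle_coloring.simps(2)[of ?s] Z1_def
    by (intro exI conjI) (rule twist(1), assumption, rule refl)
  hence B: "S3.tangle_coloring ?s ?B Z1 []" by simp
  have A: "S3.tangle_coloring [] ?A (set ?s) ?s"
    unfolding S3.minima_coloring using ghc by (intro bexI[of _ g] bexI[of _ h]) simp_all
  have "set ?s1 \<subseteq> Q" using FQ sQ by auto
  hence Z1Q: "set ?s \<union> Z1 \<subseteq> Q" unfolding Z1_def using sQ Z(3) by blast
  have "Q \<subseteq> carrier S3 - {\<one>\<^bsub>S3\<^esub>}" by (auto simp: Q_def simp flip: rotation_0)
  with Z1Q have "set ?s \<union> Z1 \<subseteq> carrier S3 - {\<one>\<^bsub>S3\<^esub>}" by (rule subset_trans)
  then obtain \<Gamma> where \<Gamma>: "S3_coloring ?D \<Gamma>" "upward_color ?D \<Gamma> ` points ?D = set ?s \<union> Z1"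
    and up: "\<And>j. j < length ?s \<Longrightarrow> upward_color ?D \<Gamma> (length (?A :: bool diagram), j) = ?s ! j"
    by (rule levels_coloring[OF D'(1) A B]) (rule that, assumption+)
  have car: "\<Gamma> (arc_of ?D p) \<in> carrier S3" "\<Gamma> (arc_of ?D p) \<in> \<Gamma> ` arcs ?D" if "p \<in> points ?D" for p
    using coloring_carrier[OF \<Gamma>(1) that] that by (auto simp: arcs_def)
  have "\<forall>g \<in> Q. inv\<^bsub>S3\<^esub> g \<in> Q" by (simp add: Q_def)
  from upward_colors_subset[OF \<Gamma>(1) this] have sub: "\<Gamma> ` arcs ?D \<subseteq> Q"
    using Z1Q by (simp only: \<Gamma>(2))
  have refl: "reflection i \<in> \<Gamma> ` arcs ?D" if i: "reflection i \<in> set ?s \<union> Z1" for i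
  proof -
    obtain p where p: "p \<in> points ?D" "upward_color ?D \<Gamma> p = reflection i"
    proof -
      from i have "reflection i \<in> upward_color ?D \<Gamma> ` points ?D" unfolding \<Gamma>(2) .
      thus thesis by (rule imageE) (rule that, assumption, rule sym)
    qed
    hence "\<Gamma> (arc_of ?D p) = S3.upward (level ?D (fst p) ! snd p) (reflection i)"
      using car(1)[OF p(1)] by (metis upward_color_def S3.upward_upward)
    thus ?thesis using car(2)[OF p(1)] by (simp add: S3.upward_def split: if_splits)
  qed
  have "reflection 0 \<in> set ?s" using gh by auto
  moreover have "reflection (- 2) \<in> Z1" using F(2) Z(2) unfolding Z1_def by blast
  ultimately have refls: "{reflection 0, reflection (- 2)} \<subseteq> \<Gamma> ` arcs ?D" using refl by blast
  \<comment> \<open>At the first inserted crossing the rotation strand passes under the reflection strand.  Its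
    color is inverted there while its direction is kept, so both rotations are colors of arcs.\<close>
  have rots: "{rotation 1, rotation (- 1)} \<subseteq> \<Gamma> ` arcs ?D"
  proof -
    have h: "2 < length ?D" "?D ! 2 = (1, Cross b)" by simp_all
    have pts: "(2, 1) \<in> points ?D" "(2, 2) \<in> points ?D" "(3, 1) \<in> points ?D" "(3, 2) \<in> points ?D"
      using crossing_points[OF D'(1) h, of 2] crossing_points[OF D'(1) h, of 3]
      by (simp_all add: numeral_eq_Suc)
    have "level ?D 3 = next_level (level ?D 2) (1, Cross b)" "admissible (level ?D 2) (1, Cross b)"
      using level_Suc[OF h(1)] admissible_level[OF D'(1) h(1)] by (simp_all add: h(2) numeral_3_eq_3)
    hence lev: "level ?D 3 ! 1 = level ?D 2 ! 2" "level ?D 3 ! 2 = level ?D 2 ! 1"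
      using next_level_cross[of "level ?D 2" 1 b] by (simp_all add: numeral_2_eq_2)
    have "crossing_at ?D 2" using h unfolding crossing_at_def by blast
    hence "crossing_rule ?D \<Gamma> 2" using \<Gamma>(1) unfolding S3_coloring_def crossing_rule_def by blast
    moreover have "\<Gamma> \<in> arcs ?D \<rightarrow> carrier S3" using \<Gamma>(1) by (auto simp: S3_coloring_def)
    ultimately have cross: "(upward_color ?D \<Gamma> (2 + 1, 1), upward_color ?D \<Gamma> (2 + 1, 1 + 1)) =
        S3.half_twist b (upward_color ?D \<Gamma> (2, 1), upward_color ?D \<Gamma> (2, 1 + 1))"
      using crossing_rule_upward[OF D'(1) h, of \<Gamma>] by (simp only: simp_thms)
    have sums: "1 + 1 = (2 :: nat)" "2 + 1 = (3 :: nat)" "length (?A :: bool diagram) = 2" by simp_all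
    have "upward_color ?D \<Gamma> (2, 1) = inv\<^bsub>S3\<^esub> g" "upward_color ?D \<Gamma> (2, 2) = h"
      using up[of 1] up[of 2] unfolding sums by simp_all
    moreover from this have "(upward_color ?D \<Gamma> (3, 1), upward_color ?D \<Gamma> (3, 2)) =
        S3.half_twist b (inv\<^bsub>S3\<^esub> g, h)"
      using cross unfolding sums by (simp only:)
    ultimately consider
      "upward_color ?D \<Gamma> (2, 2) = rotation 1" "upward_color ?D \<Gamma> (3, 1) = rotation (- 1)"
      | "upward_color ?D \<Gamma> (3, 2) = rotation 1" "upward_color ?D \<Gamma> (2, 1) = rotation (- 1)"
      using gh by auto
    thus ?thesis
    proof cases
      case 1
      hence "{rotation 1, rotation (- 1)} = {\<Gamma> (arc_of ?D (2, 2)), \<Gamma> (arc_of ?D (3, 1))}"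
        using car(1) pts lev unfolding upward_color_def by (intro opposite_rotations) auto
      thus ?thesis using car(2) pts by simp
    next
      case 2
      hence "{rotation 1, rotation (- 1)} = {\<Gamma> (arc_of ?D (3, 2)), \<Gamma> (arc_of ?D (2, 1))}"
        using car(1) pts lev unfolding upward_color_def by (intro opposite_rotations) auto
      thus ?thesis using car(2) pts by simp
    qed
  qed
  have "\<Gamma> ` arcs ?D = Q" using sub refls rots unfolding Q_def by blast
  hence "card (\<Gamma> ` arcs ?D) = 4" by (simp add: Q_def)
  thus ?thesis using \<Gamma>(1) D'(2) unfolding S3_colorable_def S3_n_coloring_def by blast
qed

lemma four_colors_sufficient:
  assumes D: "oriented_diagram D" "forget_orientation D = double_twist k l"
    and kl: "[k * l = 3] (mod 4)"
  shows "S3_colorable 4 (link_of D)"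
proof -
  have "(k mod 4) * (l mod 4) mod 4 = 3" using kl by (simp add: cong_def mod_mult_eq)
  moreover have "k mod 4 \<in> {0, 1, 2, 3}" "l mod 4 \<in> {0, 1, 2, 3}" by auto
  ultimately consider "k mod 4 = 1" "l mod 4 = 3" | "k mod 4 = 3" "l mod 4 = 1" by auto
  thus ?thesis
  proof cases
    case 1
    hence "(- l) mod 4 = 1" by presburger
    with 1 show ?thesis
      by (intro four_colors_diagram[OF D, of True 0 0]) (simp_all add: mixed_twists_def)
  next
    case 2
    hence "(3 + k) mod 4 = 2" "(1 - l) mod 4 = 0" by presburger+
    with 2 show ?thesis
      by (intro four_colors_diagram[OF D, of False 3 1]) (simp_all add: mixed_twists_def)
  qed
qed

theorem proposition4p2:
  fixes k l :: int and D :: "bool diagram"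
  assumes "oriented_diagram D"
    and "forget_orientation D = double_twist k l"
  shows "(S3_colorable 4 (link_of D) \<longleftrightarrow> [k * l = 3] (mod 4)) \<and>
         (S3_colorable 3 (link_of D) \<longleftrightarrow> [k * l = 2] (mod 3))"
  using four_colors_necessary four_colors_sufficient three_colors_necessary three_colors_sufficient
    assms by blast

end
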